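(* On a smooth surface $M$, let $([\nabla],[h])$ be an exact Riemannian signature Einstein AH structure with negative weighted scalar curvature $R$. Let $\hat M$, the Thomas connection $\hat\nabla$, and the function $F$ on $\hat M$ be as defined in the context. For each $C>0$ let $\hat M_C=\{x\in\hat M: F(x)>-\log C\}$ and, for $t>-\log C$, $$\Psi(t)=\int_{e^{-t/3}}^{C^{1/3}}(C-r^3)^{1/3}\,dr .$$ Then with $\phi=\Psi(F)$ the tensor $\phi_{IJ}=\hat\nabla_Id\phi_J$ is a Riemannian signature Monge–Ampère metric on $\hat M_C$.
   Context: A projective structure $[\nabla]$ is a class of torsion-free affine connections with the same unparametrized geodesics. An AH structure on a surface is a pair $([\nabla],[h])$ of a projective structure and a conformal structure. Let $H_{ij}=|\det h|^{-1/2}h_{ij}$ (independent of $h\in[h]$), with inverse $H^{ij}$. The aligned representative is the unique torsion-free $\nabla\in[\nabla]$ with $\nabla_{[i}H_{j]k}=0$; henceforth $\nabla$ denotes it. Curvature: $2\nabla_{[i}\nabla_{j]}X^k=R_{ijp}{}^kX^p$, $R_{ij}=R_{pij}{}^p$, $R=H^{ij}R_{ij}$ (weighted scalar curvature, a section of $|\mathrm{Det}\,T^*M|$), $F_{ij}=-R_{[ij]}$. The AH structure is Einstein if $R_{(ij)}=\tfrac12RH_{ij}$ and $\nabla_iR+2H^{pq}\nabla_qF_{ip}=0$; exact if some $h\in[h]$ satisfies $\nabla|\det h|=0$ (then $F_{ij}=0$ and an Einstein structure has $\nabla R=0$ and $[\nabla]$ projectively flat). $\rho:\hat M\to M$ is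 the principal $\mathbb R^\times$-bundle whose third power is the complement of the zero section in $\mathrm{Det}\,T^*M$, so each $\theta\in\hat M$ over $x$ has a cube $\theta^3\in \mathrm{Det}\,T_x^*M\setminus\{0\}$ and $(r\theta)^3=r^3\theta^3$. $\mathbb E$ is the vector field generating the dilations $\theta\mapsto e^t\theta$. The connection $\nabla$ induces a principal connection $\beta$ on $\hat M$ (via $\mathrm{Det}\,T^*M$), with $\beta(\mathbb E)=1$; $\hat X$ denotes the horizontal lift of a vector field $X$ on $M$. The Thomas connection $\hat\nabla$ is the torsion-free connection on $\hat M$ with $\hat\nabla_I\mathbb E^J=\delta_I{}^J$ and $\hat\nabla_{\hat X}\hat Y=\widehat{\nabla_XY}+P(X,Y)\mathbb E$, where $P_{ij}=-R_{(ij)}-\tfrac13R_{[ij]}$; it is flat iff $[\nabla]$ is projectively flat. $\tilde R$ is the negative function on $\hat M$ with $R_x=\tilde R(\theta)|\theta^3|$ (homogeneous of degree $-3$). Set $\tilde v=(\tilde R/2)^{-2/3}=2^{2/3}|\tilde R|^{-2/3}>0$ and $F=-\tfrac32\log\tilde v$ (so $F(e^t\theta)=F(\theta)-3t$). A metric $g$ of the form $\hat\nabla d\phi$, with $\hat\nabla$ a flat torsion-free affine connection, is Monge–Ampère if $\hat\nabla_Id(\log|\det g/\mu^2|)_J=0$ for local $\hat\nabla$-parallel volume forms $\mu$ (vanishing Kähler affine Ricci tensor). *)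

theory Defs
  imports "HOL-Analysis.Analysis"
begin

section \<open>Smooth functions and smooth manifolds\<close>

text \<open>\<open>Ck_on k S f\<close> is meant for open \<open>S\<close>: all iterated partial derivatives of \<open>f\<close> up to
  order \<open>k\<close> exist and are continuous on \<open>S\<close>.\<close>

primrec Ck_on :: "nat \<Rightarrow> 'e::euclidean_space set \<Rightarrow> ('e \<Rightarrow> 'f::real_normed_vector) \<Rightarrow> bool" where
  "Ck_on 0 = (\<lambda>S f. continuous_on S f)"
| "Ck_on (Suc k) = (\<lambda>S f. (\<forall>x\<in>S. f differentiable (at x)) \<and>
      (\<forall>b\<in>Basis. Ck_on k S (\<lambda>x. frechet_derivative f (at x) b)))"

definition smooth_on :: "'e::euclidean_space set \<Rightarrow> ('e \<Rightarrow> 'f::real_normed_vector) \<Rightarrow> bool" where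
  "smooth_on S f \<longleftrightarrow> (\<forall>k. Ck_on k S f)"

definition pd :: "'n::finite \<Rightarrow> (real^'n \<Rightarrow> 'f::real_normed_vector) \<Rightarrow> real^'n \<Rightarrow> 'f" where
  "pd a f u = frechet_derivative f (at u) (axis a 1)"

text \<open>An atlas is a family of charts, with index set \<open>chart_ids\<close>; the underlying point set is the
  union of the chart domains. A geometric object on the manifold is the family, indexed by the
  charts, of its components, as functions of the chart coordinates in \<open>real^'n\<close>, subject to the
  transformation law appropriate for the object. Only the components at coordinates of points of
  the chart domains are meaningful.\<close>

record ('i, 'a, 'n) atlas =
  chart_ids :: "'i set"
  chart_dom :: "'i \<Rightarrow> 'a set"
  coord :: "'i \<Rightarrow> 'a \<Rightarrow> real^'n"

definition carrier :: "('i, 'a, 'n::finite) atlas \<Rightarrow> 'a set" where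
  "carrier A = (\<Union>i\<in>chart_ids A. chart_dom A i)"

definition img :: "('i, 'a, 'n::finite) atlas \<Rightarrow> 'a set \<Rightarrow> 'i \<Rightarrow> (real^'n) set" where
  "img A W i = coord A i ` (chart_dom A i \<inter> W)"

definition transition :: "('i, 'a, 'n::finite) atlas \<Rightarrow> 'i \<Rightarrow> 'i \<Rightarrow> real^'n \<Rightarrow> real^'n" where
  "transition A i j = coord A j \<circ> inv_into (chart_dom A i) (coord A i)"

definition trans_jac :: "('i, 'a, 'n::finite) atlas \<Rightarrow> 'i \<Rightarrow> 'i \<Rightarrow> real^'n \<Rightarrow> real^'n^'n" where
  "trans_jac A i j u = jacobian (transition A i j) (at u)"

definition smooth_atlas :: "('i, 'a, 'n::finite) atlas \<Rightarrow> bool" where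
  "smooth_atlas A \<longleftrightarrow>
    (\<forall>i\<in>chart_ids A. inj_on (coord A i) (chart_dom A i) \<and> open (coord A i ` chart_dom A i)) \<and>
    (\<forall>i\<in>chart_ids A. \<forall>j\<in>chart_ids A.
        open (img A (chart_dom A j) i) \<and> smooth_on (img A (chart_dom A j) i) (transition A i j))"

definition manifold_topology :: "('i, 'a, 'n::finite) atlas \<Rightarrow> 'a topology" where
  "manifold_topology A =
     topology (\<lambda>W. W \<subseteq> carrier A \<and> (\<forall>i\<in>chart_ids A. open (img A W i)))"

lemma openin_manifold_topology:
  assumes "smooth_atlas A"
  shows "openin (manifold_topology A) W \<longleftrightarrow>
           W \<subseteq> carrier A \<and> (\<forall>i\<in>chart_ids A. open (img A W i))"
proof -
  have inter: "img A (V \<inter> W) i = img A V i \<inter> img A W i" if "i \<in> chart_ids A" for V W i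
    using assms that unfolding smooth_atlas_def img_def inj_on_def by blast
  have union: "img A (\<Union>K) i = (\<Union>W\<in>K. img A W i)" for K i
    unfolding img_def by blast
  have "istopology (\<lambda>W. W \<subseteq> carrier A \<and> (\<forall>i\<in>chart_ids A. open (img A W i)))"
    unfolding istopology_def by (auto simp: inter union)
  then show ?thesis
    unfolding manifold_topology_def by (simp add: topology_inverse')
qed

definition smooth_manifold :: "('i, 'a, 'n::finite) atlas \<Rightarrow> bool" where
  "smooth_manifold A \<longleftrightarrow> smooth_atlas A \<and>
     Hausdorff_space (manifold_topology A) \<and> second_countable (manifold_topology A)"

definition local_rep :: "('i, 'a, 'n::finite) atlas \<Rightarrow> 'i \<Rightarrow> ('a \<Rightarrow> real) \<Rightarrow> real^'n \<Rightarrow> real" where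
  "local_rep A i f = f \<circ> inv_into (chart_dom A i) (coord A i)"

definition smooth_fun :: "('i, 'a, 'n::finite) atlas \<Rightarrow> 'a set \<Rightarrow> ('a \<Rightarrow> real) \<Rightarrow> bool" where
  "smooth_fun A W f \<longleftrightarrow> (\<forall>i\<in>chart_ids A. smooth_on (img A W i) (local_rep A i f))"


section \<open>Metrics and affine connections\<close>

type_synonym ('i, 'n) tensor2 = "'i \<Rightarrow> real^'n \<Rightarrow> real^'n^'n"

text \<open>\<open>\<Gamma> i u $ a $ b $ k\<close> is the Christoffel symbol $\Gamma_{ab}{}^k$ of the connection at the point with
  coordinates \<open>u\<close> in chart \<open>i\<close>; the first lower index is the index of differentiation.\<close>

type_synonym 'n christoffel = "real^'n \<Rightarrow> real^'n^'n^'n"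
type_synonym ('i, 'n) connection = "'i \<Rightarrow> 'n christoffel"

text \<open>Pseudo-Riemannian metric of any signature on the open subset \<open>W\<close>.\<close>

definition metric_on :: "('i, 'a, 'n::finite) atlas \<Rightarrow> 'a set \<Rightarrow> ('i, 'n) tensor2 \<Rightarrow> bool" where
  "metric_on A W g \<longleftrightarrow>
    (\<forall>i\<in>chart_ids A. smooth_on (img A W i) (g i) \<and>
        (\<forall>u\<in>img A W i. transpose (g i u) = g i u \<and> det (g i u) \<noteq> 0)) \<and>
    (\<forall>i\<in>chart_ids A. \<forall>j\<in>chart_ids A. \<forall>u\<in>img A (W \<inter> chart_dom A j) i.
        g i u = transpose (trans_jac A i j u) ** g j (transition A i j u) ** trans_jac A i j u)"

definition riemannian_on :: "('i, 'a, 'n::finite) atlas \<Rightarrow> 'a set \<Rightarrow> ('i, 'n) tensor2 \<Rightarrow> bool" where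
  "riemannian_on A W g \<longleftrightarrow> metric_on A W g \<and>
    (\<forall>i\<in>chart_ids A. \<forall>u\<in>img A W i. \<forall>v. v \<noteq> 0 \<longrightarrow> v \<bullet> (g i u *v v) > 0)"

definition affine_connection :: "('i, 'a, 'n::finite) atlas \<Rightarrow> ('i, 'n) connection \<Rightarrow> bool" where
  "affine_connection A \<Gamma> \<longleftrightarrow>
    (\<forall>i\<in>chart_ids A. smooth_on (img A (carrier A) i) (\<Gamma> i)) \<and>
    (\<forall>i\<in>chart_ids A. \<forall>j\<in>chart_ids A. \<forall>u\<in>img A (chart_dom A j) i. \<forall>a b r.
        (\<Sum>k\<in>UNIV. \<Gamma> i u $ a $ b $ k * trans_jac A i j u $ r $ k) =
          pd a (\<lambda>w. trans_jac A i j w $ r $ b) u +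
          (\<Sum>p\<in>UNIV. \<Sum>q\<in>UNIV. \<Gamma> j (transition A i j u) $ p $ q $ r *
              trans_jac A i j u $ p $ a * trans_jac A i j u $ q $ b))"

definition torsion_free :: "('i, 'a, 'n::finite) atlas \<Rightarrow> ('i, 'n) connection \<Rightarrow> bool" where
  "torsion_free A \<Gamma> \<longleftrightarrow> (\<forall>i\<in>chart_ids A. \<forall>u\<in>img A (carrier A) i. \<forall>a b k.
      \<Gamma> i u $ a $ b $ k = \<Gamma> i u $ b $ a $ k)"

definition cov_deriv ::
  "'n::finite christoffel \<Rightarrow> (real^'n \<Rightarrow> real^'n) \<Rightarrow> (real^'n \<Rightarrow> real^'n) \<Rightarrow> real^'n \<Rightarrow> real^'n" where
  "cov_deriv G X Y u = (\<chi> k. \<Sum>a\<in>UNIV. X u $ a *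
      (pd a (\<lambda>w. Y w $ k) u + (\<Sum>b\<in>UNIV. G u $ a $ b $ k * Y u $ b)))"

text \<open>\<open>curvature G i j p k u\<close> is $R_{ijp}{}^k$, where
  $R_{ijp}{}^k X^p = \nabla_i\nabla_j X^k - \nabla_j\nabla_i X^k$ for torsion-free $\nabla$.\<close>

definition curvature ::
  "'n::finite christoffel \<Rightarrow> 'n \<Rightarrow> 'n \<Rightarrow> 'n \<Rightarrow> 'n \<Rightarrow> real^'n \<Rightarrow> real" where
  "curvature G i j p k u =
     pd i (\<lambda>w. G w $ j $ p $ k) u - pd j (\<lambda>w. G w $ i $ p $ k) u +
     (\<Sum>q\<in>UNIV. G u $ i $ q $ k * G u $ j $ p $ q - G u $ j $ q $ k * G u $ i $ p $ q)"

definition flat_on :: "('i, 'a, 'n::finite) atlas \<Rightarrow> 'a set \<Rightarrow> ('i, 'n) connection \<Rightarrow> bool" where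
  "flat_on A W \<Gamma> \<longleftrightarrow>
    (\<forall>c\<in>chart_ids A. \<forall>u\<in>img A W c. \<forall>i j p k. curvature (\<Gamma> c) i j p k u = 0)"

text \<open>$R_{ij} = R_{pij}{}^p$, which need not be symmetric, its symmetric and skew parts, and
  $F_{ij} = -R_{[ij]}$.\<close>

definition ricci :: "'n::finite christoffel \<Rightarrow> 'n \<Rightarrow> 'n \<Rightarrow> real^'n \<Rightarrow> real" where
  "ricci G i j u = (\<Sum>p\<in>UNIV. curvature G p i j p u)"

definition ricci_sym :: "'n::finite christoffel \<Rightarrow> 'n \<Rightarrow> 'n \<Rightarrow> real^'n \<Rightarrow> real" where
  "ricci_sym G i j u = (ricci G i j u + ricci G j i u) / 2"

definition ricci_skew :: "'n::finite christoffel \<Rightarrow> 'n \<Rightarrow> 'n \<Rightarrow> real^'n \<Rightarrow> real" where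
  "ricci_skew G i j u = (ricci G i j u - ricci G j i u) / 2"

definition faraday :: "'n::finite christoffel \<Rightarrow> 'n \<Rightarrow> 'n \<Rightarrow> real^'n \<Rightarrow> real" where
  "faraday G i j u = - ricci_skew G i j u"

definition conn_trace :: "'n::finite christoffel \<Rightarrow> 'n \<Rightarrow> real^'n \<Rightarrow> real" where
  "conn_trace G a u = (\<Sum>p\<in>UNIV. G u $ a $ p $ p)"

text \<open>Covariant derivatives of a section with component \<open>f\<close> of $|\mathrm{Det}\,T^*M|^w$, and of a
  covariant 2-tensor \<open>T\<close> with values in $|\mathrm{Det}\,T^*M|^w$.\<close>

definition cov_density ::
  "'n::finite christoffel \<Rightarrow> real \<Rightarrow> (real^'n \<Rightarrow> real) \<Rightarrow> 'n \<Rightarrow> real^'n \<Rightarrow> real" where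
  "cov_density G w f a u = pd a f u - w * conn_trace G a u * f u"

definition cov_tensor2 ::
  "'n::finite christoffel \<Rightarrow> real \<Rightarrow> (real^'n \<Rightarrow> real^'n^'n) \<Rightarrow> 'n \<Rightarrow> 'n \<Rightarrow> 'n \<Rightarrow> real^'n \<Rightarrow> real" where
  "cov_tensor2 G w T a b c u = pd a (\<lambda>v. T v $ b $ c) u
     - (\<Sum>p\<in>UNIV. G u $ a $ b $ p * T u $ p $ c) - (\<Sum>p\<in>UNIV. G u $ a $ c $ p * T u $ b $ p)
     - w * conn_trace G a u * T u $ b $ c"


section \<open>AH structures on surfaces\<close>

text \<open>\<open>\<gamma>\<close> is a smooth immersed curve, defined on the open interval \<open>J\<close>, whose acceleration is
  everywhere proportional to its velocity, i.e. it is a geodesic up to reparametrization.\<close>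

definition unparam_geodesic ::
  "('i, 'a, 'n::finite) atlas \<Rightarrow> ('i, 'n) connection \<Rightarrow> real set \<Rightarrow> (real \<Rightarrow> 'a) \<Rightarrow> bool" where
  "unparam_geodesic A \<Gamma> J \<gamma> \<longleftrightarrow> open J \<and> is_interval J \<and> J \<noteq> {} \<and> \<gamma> ` J \<subseteq> carrier A \<and>
    (\<forall>i\<in>chart_ids A.
      let T = {t\<in>J. \<gamma> t \<in> chart_dom A i};
          c = coord A i \<circ> \<gamma>;
          c' = (\<lambda>t. vector_derivative c (at t));
          c'' = (\<lambda>t. vector_derivative c' (at t))
      in open T \<and> smooth_on T c \<and>
         (\<forall>t\<in>T. c' t \<noteq> 0 \<and>
            (\<exists>l. \<forall>k. c'' t $ k + (\<Sum>a\<in>UNIV. \<Sum>b\<in>UNIV. \<Gamma> i (c t) $ a $ b $ k * c' t $ a * c' t $ b)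
                      = l * c' t $ k)))"

definition projective_structure ::
  "('i, 'a, 'n::finite) atlas \<Rightarrow> ('i, 'n) connection set \<Rightarrow> bool" where
  "projective_structure A P \<longleftrightarrow>
    (\<exists>\<Gamma>. affine_connection A \<Gamma> \<and> torsion_free A \<Gamma> \<and>
       P = {\<Gamma>'. affine_connection A \<Gamma>' \<and> torsion_free A \<Gamma>' \<and>
                (\<forall>J \<gamma>. unparam_geodesic A \<Gamma>' J \<gamma> \<longleftrightarrow> unparam_geodesic A \<Gamma> J \<gamma>)})"

definition conformal_structure ::
  "('i, 'a, 'n::finite) atlas \<Rightarrow> ('i, 'n) tensor2 set \<Rightarrow> bool" where
  "conformal_structure A K \<longleftrightarrow>
    (\<exists>h. metric_on A (carrier A) h \<and>
       K = {h'. metric_on A (carrier A) h' \<and>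
               (\<exists>f. smooth_fun A (carrier A) f \<and> (\<forall>x\<in>carrier A. f x > 0) \<and>
                  (\<forall>i\<in>chart_ids A. \<forall>x\<in>chart_dom A i.
                      h' i (coord A i x) = f x *\<^sub>R h i (coord A i x)))})"

definition AH_structure ::
  "('i, 'a, 2) atlas \<Rightarrow> ('i, 2) connection set \<Rightarrow> ('i, 2) tensor2 set \<Rightarrow> bool" where
  "AH_structure A P K \<longleftrightarrow> projective_structure A P \<and> conformal_structure A K"

text \<open>$H_{ij} = |\det h|^{-1/2} h_{ij}$, a $|\mathrm{Det}\,T^*M|^{-1}$-valued tensor that depends only
  on the conformal class of \<open>h\<close>. In the following definitions \<open>h\<close> is an arbitrary representative of
  the conformal structure and enters only through \<open>H\<close>.\<close>

definition unimod :: "(real^2 \<Rightarrow> real^2^2) \<Rightarrow> real^2 \<Rightarrow> real^2^2" where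
  "unimod h u = (\<bar>det (h u)\<bar> powr (-1/2)) *\<^sub>R h u"

definition aligned_rep ::
  "('i, 'a, 2) atlas \<Rightarrow> ('i, 2) connection set \<Rightarrow> ('i, 2) tensor2 \<Rightarrow> ('i, 2) connection \<Rightarrow> bool" where
  "aligned_rep A P h \<Gamma> \<longleftrightarrow> \<Gamma> \<in> P \<and>
    (\<forall>c\<in>chart_ids A. \<forall>u\<in>img A (carrier A) c. \<forall>i j k.
        cov_tensor2 (\<Gamma> c) (-1) (unimod (h c)) i j k u =
        cov_tensor2 (\<Gamma> c) (-1) (unimod (h c)) j i k u)"

text \<open>Component of the weighted scalar curvature $R = H^{ij}R_{ij}$ with respect to
  $|dx^1\wedge dx^2|$.\<close>

definition weighted_scal :: "(real^2 \<Rightarrow> real^2^2) \<Rightarrow> 2 christoffel \<Rightarrow> real^2 \<Rightarrow> real" where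
  "weighted_scal h G u =
     (\<Sum>i\<in>UNIV. \<Sum>j\<in>UNIV. matrix_inv (unimod h u) $ i $ j * ricci G i j u)"

text \<open>\<open>\<Gamma>\<close> is the aligned representative in the next definitions.\<close>

definition einstein_AH ::
  "('i, 'a, 2) atlas \<Rightarrow> ('i, 2) tensor2 \<Rightarrow> ('i, 2) connection \<Rightarrow> bool" where
  "einstein_AH A h \<Gamma> \<longleftrightarrow>
    (\<forall>c\<in>chart_ids A. \<forall>u\<in>img A (carrier A) c.
      (\<forall>i j. ricci_sym (\<Gamma> c) i j u = weighted_scal (h c) (\<Gamma> c) u / 2 * unimod (h c) u $ i $ j) \<and>
      (\<forall>i. cov_density (\<Gamma> c) 1 (weighted_scal (h c) (\<Gamma> c)) i u +
           2 * (\<Sum>p\<in>UNIV. \<Sum>q\<in>UNIV. matrix_inv (unimod (h c) u) $ p $ q *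
                  cov_tensor2 (\<Gamma> c) 0 (\<lambda>v. \<chi> r s. faraday (\<Gamma> c) r s v) q i p u) = 0))"

definition exact_AH ::
  "('i, 'a, 2) atlas \<Rightarrow> ('i, 2) tensor2 set \<Rightarrow> ('i, 2) connection \<Rightarrow> bool" where
  "exact_AH A K \<Gamma> \<longleftrightarrow> (\<exists>h\<in>K. \<forall>c\<in>chart_ids A. \<forall>u\<in>img A (carrier A) c. \<forall>i.
      cov_density (\<Gamma> c) 2 (\<lambda>v. \<bar>det (h c v)\<bar>) i u = 0)"


section \<open>The cube root bundle and the Thomas connection\<close>

text \<open>An element of $\mathrm{Det}\,T_x^*M$ is the family \<open>\<omega>\<close> of its components with respect to
  $dx^1\wedge dx^2$ in the charts around \<open>x\<close> (and \<open>0\<close> for the other indices).\<close>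

definition det_fibre :: "('i, 'a, 2) atlas \<Rightarrow> 'a \<Rightarrow> ('i \<Rightarrow> real) set" where
  "det_fibre A x = {\<omega>.
     (\<forall>i. \<not> (i \<in> chart_ids A \<and> x \<in> chart_dom A i) \<longrightarrow> \<omega> i = 0) \<and>
     (\<forall>i\<in>chart_ids A. \<forall>j\<in>chart_ids A. x \<in> chart_dom A i \<inter> chart_dom A j \<longrightarrow>
        \<omega> i = det (trans_jac A i j (coord A i x)) * \<omega> j)}"

definition cube :: "('i \<Rightarrow> real) \<Rightarrow> 'i \<Rightarrow> real" where
  "cube \<theta> = (\<lambda>i. \<theta> i ^ 3)"

text \<open>The points of $\hat M$ are the pairs \<open>(x, \<theta>)\<close> where \<open>\<theta>\<close> is a cube root of a nonzero element
  of $\mathrm{Det}\,T_x^*M$; \<open>r \<noteq> 0\<close> acts by multiplying all components of \<open>\<theta>\<close> by \<open>r\<close>. The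
  chart with index \<open>i\<close> has coordinates $(x^1, x^2, s)$ with $\theta^3 = s^3\, dx^1\wedge dx^2$.\<close>

definition Mhat :: "('i, 'a, 2) atlas \<Rightarrow> ('a \<times> ('i \<Rightarrow> real)) set" where
  "Mhat A = {(x, \<theta>). x \<in> carrier A \<and> cube \<theta> \<in> det_fibre A x - {\<lambda>_. 0}}"

definition hat_atlas :: "('i, 'a, 2) atlas \<Rightarrow> ('i, 'a \<times> ('i \<Rightarrow> real), 3) atlas" where
  "hat_atlas A = \<lparr>chart_ids = chart_ids A,
     chart_dom = (\<lambda>i. {(x, \<theta>) \<in> Mhat A. x \<in> chart_dom A i}),
     coord = (\<lambda>i (x, \<theta>). vector [coord A i x $ 1, coord A i x $ 2, \<theta> i])\<rparr>"

definition base_pt :: "real^3 \<Rightarrow> real^2" where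
  "base_pt p = vector [p $ 1, p $ 2]"

text \<open>The generator $\mathbb{E}$ of the dilations $(x, s) \mapsto (x, e^t s)$.\<close>

definition euler_field :: "real^3 \<Rightarrow> real^3" where
  "euler_field p = vector [0, 0, p $ 3]"

text \<open>A section $f\, dx^1\wedge dx^2$ of $\mathrm{Det}\,T^*M$ is parallel iff
  $df = f\,\Gamma_{ap}{}^p dx^a$; with $f = s^3$ the induced connection form on $\hat M$ is
  $\beta = s^{-1} ds - \frac13 \Gamma_{ap}{}^p dx^a$.\<close>

definition beta_form :: "2 christoffel \<Rightarrow> real^3 \<Rightarrow> real^3" where
  "beta_form G p = vector [- conn_trace G 1 (base_pt p) / 3, - conn_trace G 2 (base_pt p) / 3, 1 / p $ 3]"

definition hor_lift :: "2 christoffel \<Rightarrow> (real^2 \<Rightarrow> real^2) \<Rightarrow> real^3 \<Rightarrow> real^3" where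
  "hor_lift G X p = (let u = base_pt p in
     vector [X u $ 1, X u $ 2, p $ 3 / 3 * (\<Sum>a\<in>UNIV. conn_trace G a u * X u $ a)])"

lemma beta_form_euler_field: "p $ 3 \<noteq> 0 \<Longrightarrow> beta_form G p \<bullet> euler_field p = 1"
  by (simp add: beta_form_def euler_field_def inner_vec_def sum_3)

lemma beta_form_hor_lift: "p $ 3 \<noteq> 0 \<Longrightarrow> beta_form G p \<bullet> hor_lift G X p = 0"
  by (simp add: beta_form_def hor_lift_def Let_def inner_vec_def sum_3 sum_2 field_simps)

definition thomas_P :: "2 christoffel \<Rightarrow> 2 \<Rightarrow> 2 \<Rightarrow> real^2 \<Rightarrow> real" where
  "thomas_P G i j u = - ricci_sym G i j u - 1/3 * ricci_skew G i j u"

text \<open>Since connections are local, the horizontal lifts of the vector fields \<open>X\<close>, \<open>Y\<close> on the chart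
  domains suffice.\<close>

definition thomas_connection ::
  "('i, 'a, 2) atlas \<Rightarrow> ('i, 2) connection \<Rightarrow> ('i, 3) connection \<Rightarrow> bool" where
  "thomas_connection A \<Gamma> \<Gamma>h \<longleftrightarrow>
    affine_connection (hat_atlas A) \<Gamma>h \<and> torsion_free (hat_atlas A) \<Gamma>h \<and>
    (\<forall>i\<in>chart_ids A. \<forall>p\<in>img (hat_atlas A) (Mhat A) i.
      (\<forall>v. cov_deriv (\<Gamma>h i) (\<lambda>_. v) euler_field p = v) \<and>
      (\<forall>X Y. smooth_on (img A (carrier A) i) X \<and> smooth_on (img A (carrier A) i) Y \<longrightarrow>
        cov_deriv (\<Gamma>h i) (hor_lift (\<Gamma> i) X) (hor_lift (\<Gamma> i) Y) p =
          hor_lift (\<Gamma> i) (cov_deriv (\<Gamma> i) X Y) p +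
          (\<Sum>a\<in>UNIV. \<Sum>b\<in>UNIV. thomas_P (\<Gamma> i) a b (base_pt p) *
              X (base_pt p) $ a * Y (base_pt p) $ b) *\<^sub>R euler_field p))"

text \<open>\<open>Rt\<close> is the function on $\hat M$ with $R_x = \tilde R(\theta)\,|\theta^3|$.\<close>

definition lifted_scal ::
  "('i, 'a, 2) atlas \<Rightarrow> ('i, 2) tensor2 \<Rightarrow> ('i, 2) connection \<Rightarrow> ('a \<times> ('i \<Rightarrow> real) \<Rightarrow> real) \<Rightarrow> bool" where
  "lifted_scal A h \<Gamma> Rt \<longleftrightarrow>
    (\<forall>(x, \<theta>)\<in>Mhat A. \<forall>i\<in>chart_ids A. x \<in> chart_dom A i \<longrightarrow>
       weighted_scal (h i) (\<Gamma> i) (coord A i x) = Rt (x, \<theta>) * \<bar>cube \<theta> i\<bar>)"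

definition vtilde :: "('p \<Rightarrow> real) \<Rightarrow> 'p \<Rightarrow> real" where
  "vtilde Rt p = 2 powr (2/3) * \<bar>Rt p\<bar> powr (-2/3)"

definition Ffun :: "('p \<Rightarrow> real) \<Rightarrow> 'p \<Rightarrow> real" where
  "Ffun Rt p = - 3/2 * ln (vtilde Rt p)"


section \<open>Monge--Ampere metrics\<close>

definition hess :: "'n::finite christoffel \<Rightarrow> (real^'n \<Rightarrow> real) \<Rightarrow> real^'n \<Rightarrow> real^'n^'n" where
  "hess G f u = (\<chi> a b. pd a (pd b f) u - (\<Sum>k\<in>UNIV. G u $ a $ b $ k * pd k f u))"

definition hess_tensor ::
  "('i, 'a, 'n::finite) atlas \<Rightarrow> ('i, 'n) connection \<Rightarrow> ('a \<Rightarrow> real) \<Rightarrow> ('i, 'n) tensor2" where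
  "hess_tensor A \<Gamma> \<phi> i u = hess (\<Gamma> i) (local_rep A i \<phi>) u"

definition parallel_volume_form ::
  "('i, 'a, 'n::finite) atlas \<Rightarrow> 'a set \<Rightarrow> ('i, 'n) connection \<Rightarrow> ('i \<Rightarrow> real^'n \<Rightarrow> real) \<Rightarrow> bool" where
  "parallel_volume_form A V \<Gamma> \<mu> \<longleftrightarrow>
    (\<forall>i\<in>chart_ids A. smooth_on (img A V i) (\<mu> i) \<and>
       (\<forall>u\<in>img A V i. \<mu> i u \<noteq> 0 \<and> (\<forall>a. pd a (\<mu> i) u - conn_trace (\<Gamma> i) a u * \<mu> i u = 0))) \<and>
    (\<forall>i\<in>chart_ids A. \<forall>j\<in>chart_ids A. \<forall>u\<in>img A (V \<inter> chart_dom A j) i.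
       \<mu> i u = det (trans_jac A i j u) * \<mu> j (transition A i j u))"

definition monge_ampere_on ::
  "('i, 'a, 'n::finite) atlas \<Rightarrow> 'a set \<Rightarrow> ('i, 'n) connection \<Rightarrow> ('i, 'n) tensor2 \<Rightarrow> bool" where
  "monge_ampere_on A W \<Gamma> g \<longleftrightarrow>
    openin (manifold_topology A) W \<and>
    affine_connection A \<Gamma> \<and> torsion_free A \<Gamma> \<and> flat_on A W \<Gamma> \<and> metric_on A W g \<and>
    (\<exists>\<phi>. smooth_fun A W \<phi> \<and> (\<forall>i\<in>chart_ids A. \<forall>u\<in>img A W i. g i u = hess_tensor A \<Gamma> \<phi> i u)) \<and>
    (\<forall>V \<mu>. openin (manifold_topology A) V \<and> V \<subseteq> W \<and> parallel_volume_form A V \<Gamma> \<mu> \<longrightarrow>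
       (\<forall>i\<in>chart_ids A. \<forall>u\<in>img A V i.
          hess (\<Gamma> i) (\<lambda>w. ln \<bar>det (g i w) / (\<mu> i w)^2\<bar>) u = 0))"

definition Psi :: "real \<Rightarrow> real \<Rightarrow> real" where
  "Psi C t = integral {exp (- t / 3) .. C powr (1/3)} (\<lambda>r. (C - r^3) powr (1/3))"

definition Mhat_sub :: "('i, 'a, 2) atlas \<Rightarrow> ('a \<times> ('i \<Rightarrow> real) \<Rightarrow> real) \<Rightarrow> real \<Rightarrow> ('a \<times> ('i \<Rightarrow> real)) set" where
  "Mhat_sub A F C = {p \<in> Mhat A. F p > - ln C}"

end

theory Submission
  imports Defs
begin

text \<open>Put $\varrho = e^{-F/3}$. In a chart, with fibre coordinate $s$ and $w < 0$ the component of $R$,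
  this is $\varrho = |s|\,|w/2|^{-1/3}$. Exactness makes the trace of the connection closed, so that the
  Ricci tensor is symmetric, the Einstein equations give $\nabla R = 0$ and $P = -\frac12 R H$, and hence
  $d\varrho = \varrho\beta$ and $\hat\nabla d\varrho = -\varrho P$ as a horizontal tensor. Since $\phi$
  is a function of $\varrho$ with derivative $-q$, where $q = (C-\varrho^3)^{1/3}$,
  \[ \hat\nabla d\phi = \varrho^4 q^{-2}\, \beta\otimes\beta + \frac12 \varrho\, q\, |R|\, H, \]
  which is positive definite, and as $\det H = 1$ and $\frac12|w|\varrho^3 = |s|^3$ its determinant is exactly
  $s^4$. A parallel volume form is locally a constant multiple of $s^2\, dx^1\wedge dx^2\wedge ds$, so the
  ratio in the Monge--Ampere condition is locally constant. Flatness of the Thomas connection is the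
  vanishing of the Cotton tensor $\nabla_{[i}P_{j]k}$, which follows from $\nabla R = 0$ and the alignment
  condition $\nabla_{[i}H_{j]k} = 0$.\<close>

section \<open>Calculus of smooth functions\<close>

text \<open>The integrand of \<open>Psi\<close> is forced by the equation. For a function f of rho
  alone, the formulas for the differential and the Hessian of rho give Hess f = f'' rho^2 beta beta
  - f' rho (|R|/2) H. As beta has fibre component 1/s and det H = 1, the determinant is f'' f'^2
  rho^4 (w/2)^2 / s^2, and eliminating w leaves f'' f'^2 rho^(-2) s^4. A constant ratio to s^4, the
  square of a parallel volume, therefore means that the derivative of f'^3 is a constant multiple of
  rho^2; the choice f'^3 = rho^3 - C is f' = -q. The condition F > - ln C is rho < C^(1/3), that is
  q > 0; as rho tends to C^(1/3) the coefficient of H tends to 0 and that of beta beta blows up. The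
  Thomas connection is given only by its action on the Euler field and on horizontal lifts, so its
  Christoffel symbols have to be solved for. The fibre coordinate s refers to the coordinate volume
  form, which brings the trace of the connection into these symbols; the non-tensorial terms have to
  cancel in each coordinate identity.\<close>

lemma frechet_derivative_eq:
  "(f has_derivative D) (at x) \<Longrightarrow> frechet_derivative f (at x) = D"
  using frechet_derivative_at by metis

lemma Ck_on_cong_imp:
  assumes "open S" "\<And>x. x \<in> S \<Longrightarrow> f x = g x" "Ck_on k S f"
  shows "Ck_on k S g"
  using assms(2,3)
proof (induction k arbitrary: f g)
  case 0
  then show ?case using continuous_on_cong[of S S f g] by simp
next
  case (Suc k)
  have d: "f differentiable at x" if "x \<in> S" for x using Suc.prems that by auto
  have g: "(g has_derivative frechet_derivative f (at x)) (at x)" if "x \<in> S" for x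
    using has_derivative_transform_within_open[OF _ assms(1) that Suc.prems(1)] d[OF that]
    by (simp add: frechet_derivative_works)
  have "Ck_on k S (\<lambda>x. frechet_derivative g (at x) b)" if "b \<in> Basis" for b
    by (rule Suc.IH[of "\<lambda>x. frechet_derivative f (at x) b"])
      (use Suc.prems that frechet_derivative_eq[OF g] in auto)
  then show ?case using g by (auto simp: differentiable_def)
qed

text \<open>Reduces each closure property to a derivative formula: any \<open>D\<close> known to be
  the derivative may replace \<open>frechet_derivative\<close>, since on an open set the two agree
  near every point.\<close>

lemma Ck_on_SucI:
  assumes "open S" "\<And>x. x \<in> S \<Longrightarrow> (f has_derivative D x) (at x)"
    "\<And>b. b \<in> Basis \<Longrightarrow> Ck_on k S (\<lambda>x. D x b)"
  shows "Ck_on (Suc k) S f"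
proof -
  have "Ck_on k S (\<lambda>x. frechet_derivative f (at x) b)" if "b \<in> Basis" for b
    by (rule Ck_on_cong_imp[OF assms(1) _ assms(3)[OF that]])
      (simp add: frechet_derivative_eq[OF assms(2)])
  then show ?thesis using assms(2) by (auto simp: differentiable_def)
qed

lemma Ck_on_Suc_has_derivative:
  "Ck_on (Suc k) S f \<Longrightarrow> x \<in> S \<Longrightarrow> (f has_derivative frechet_derivative f (at x)) (at x)"
  by (simp add: frechet_derivative_works)

lemma Ck_on_SucD: "Ck_on (Suc k) S f \<Longrightarrow> Ck_on k S f"
proof (induction k arbitrary: f)
  case 0
  then show ?case
    by (auto intro!: continuous_at_imp_continuous_on differentiable_imp_continuous_within)
next
  case (Suc k)
  show ?case unfolding Ck_on.simps(2)[of k]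
    using Suc.prems Suc.IH by (auto simp del: Ck_on.simps simp: Ck_on.simps(2)[of "Suc k"])
qed

lemma Ck_on_subset: "Ck_on k S f \<Longrightarrow> T \<subseteq> S \<Longrightarrow> Ck_on k T f"
  by (induction k arbitrary: f) (auto intro: continuous_on_subset)

lemma Ck_on_const: "Ck_on k S (\<lambda>_. c)"
  by (induction k arbitrary: c) auto

lemma Ck_on_bounded_linear:
  assumes "bounded_linear L" "open S" "Ck_on k S f"
  shows "Ck_on k S (\<lambda>x. L (f x))"
  using assms(3)
proof (induction k arbitrary: f)
  case 0
  then show ?case using bounded_linear.continuous_on[OF assms(1)] by auto
next
  case (Suc k)
  show ?case
    by (rule Ck_on_SucI[OF assms(2) bounded_linear.has_derivative[OF assms(1)
          Ck_on_Suc_has_derivative[OF Suc.prems]]]) (use Suc in auto)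
qed

lemma Ck_on_add:
  assumes "open S" "Ck_on k S f" "Ck_on k S g"
  shows "Ck_on k S (\<lambda>x. f x + g x)"
  using assms(2,3)
proof (induction k arbitrary: f g)
  case 0
  then show ?case by (auto intro: continuous_on_add)
next
  case (Suc k)
  show ?case
    by (rule Ck_on_SucI[OF assms(1) has_derivative_add[OF Ck_on_Suc_has_derivative[OF Suc.prems(1)]
            Ck_on_Suc_has_derivative[OF Suc.prems(2)]]]) (use Suc in auto)
qed

lemma Ck_on_sum:
  assumes "open S" "\<And>i. i \<in> I \<Longrightarrow> Ck_on k S (f i)"
  shows "Ck_on k S (\<lambda>x. \<Sum>i\<in>I. f i x)"
  using assms(2) by (induction I rule: infinite_finite_induct)
    (auto intro: Ck_on_const Ck_on_add[OF assms(1)])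

lemma Ck_on_mult:
  fixes f g :: "'e::euclidean_space \<Rightarrow> real"
  assumes "open S" "Ck_on k S f" "Ck_on k S g"
  shows "Ck_on k S (\<lambda>x. f x * g x)"
  using assms(2,3)
proof (induction k arbitrary: f g)
  case 0
  then show ?case by (auto intro: continuous_on_mult)
next
  case (Suc k)
  show ?case
    by (rule Ck_on_SucI[OF assms(1) has_derivative_mult[OF Ck_on_Suc_has_derivative[OF Suc.prems(1)]
            Ck_on_Suc_has_derivative[OF Suc.prems(2)]]])
      (use Suc Ck_on_SucD[OF Suc.prems(1)] Ck_on_SucD[OF Suc.prems(2)]
        in \<open>auto intro!: Ck_on_add assms(1)\<close>)
qed

lemma has_derivative_powr_const:
  fixes f :: "'e::real_normed_vector \<Rightarrow> real"
  assumes "(f has_derivative D) (at x)" "f x > 0"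
  shows "((\<lambda>x. f x powr c) has_derivative (\<lambda>h. c * f x powr (c - 1) * D h)) (at x)"
  by (rule has_derivative_eq_rhs[OF has_derivative_powr[OF assms(1) has_derivative_const assms(2)]])
    (use assms(2) in \<open>auto simp: powr_diff field_simps\<close>)

lemma Ck_on_powr:
  fixes f :: "'e::euclidean_space \<Rightarrow> real"
  assumes "open S" "Ck_on k S f" "\<And>x. x \<in> S \<Longrightarrow> f x > 0"
  shows "Ck_on k S (\<lambda>x. f x powr c)"
  using assms(2,3)
proof (induction k arbitrary: c)
  case 0
  then show ?case using less_irrefl by (fastforce intro!: continuous_on_powr continuous_on_const)
next
  case (Suc k)
  have "Ck_on k S (\<lambda>x. f x powr (c - 1))"
    using Suc.IH Ck_on_SucD[OF Suc.prems(1)] Suc.prems(2) by blast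
  then show ?case
    by (intro Ck_on_SucI[OF assms(1) has_derivative_powr_const[OF
            Ck_on_Suc_has_derivative[OF Suc.prems(1)] Suc.prems(2)]])
      (use Suc.prems in \<open>auto intro!: Ck_on_mult Ck_on_const assms(1)\<close>)
qed

text \<open>The partial derivatives of the composite are combinations, with constant coefficients,
  of those of \<open>f\<close> composed with \<open>L\<close>, so the induction closes without
  products. It is applied to the projection \<open>base_pt\<close>.\<close>

lemma Ck_on_compose_linear:
  fixes L :: "'d::euclidean_space \<Rightarrow> 'e::euclidean_space"
  assumes "bounded_linear L" "open S" "Ck_on k S f"
  shows "Ck_on k (L -` S) (\<lambda>x. f (L x))"
  using assms(3)
proof (induction k arbitrary: f)
  case 0
  then show ?case
    using continuous_on_compose2[of S f "L -` S" L]
      linear_continuous_on[OF assms(1)] by auto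
next
  case (Suc k)
  have o: "open (L -` S)"
    using continuous_open_vimage[OF assms(2)] linear_continuous_at[OF assms(1)] by blast
  let ?D = "\<lambda>x. frechet_derivative f (at (L x))"
  have D: "((\<lambda>x. f (L x)) has_derivative (\<lambda>h. ?D x (L h))) (at x)" if "x \<in> L -` S" for x
    using has_derivative_compose[OF bounded_linear_imp_has_derivative[OF assms(1), of "at x"]
        Ck_on_Suc_has_derivative[OF Suc.prems]] that by simp
  have eq: "?D x (L b) = (\<Sum>c\<in>Basis. (L b \<bullet> c) *\<^sub>R ?D x c)" if "x \<in> L -` S" for x b
  proof -
    have "linear (?D x)"
      using Ck_on_Suc_has_derivative[OF Suc.prems] that has_derivative_linear by auto
    then show ?thesis
      by (subst euclidean_representation[of "L b", symmetric]) (simp add: linear_sum linear_cmul)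
  qed
  have "Ck_on k (L -` S) (\<lambda>x. ?D x (L b))" for b
  proof (rule Ck_on_cong_imp[OF o eq[symmetric]])
    show "Ck_on k (L -` S) (\<lambda>x. \<Sum>c\<in>Basis. (L b \<bullet> c) *\<^sub>R ?D x c)"
      by (intro Ck_on_sum o Ck_on_bounded_linear[OF bounded_linear_scaleR_right])
        (use Suc in auto)
  qed auto
  then show ?case using Ck_on_SucI[OF o D] by blast
qed

lemma smooth_on_cong:
  "open S \<Longrightarrow> (\<And>x. x \<in> S \<Longrightarrow> f x = g x) \<Longrightarrow> smooth_on S f \<Longrightarrow> smooth_on S g"
  unfolding smooth_on_def using Ck_on_cong_imp by blast

lemma smooth_on_subset: "smooth_on S f \<Longrightarrow> T \<subseteq> S \<Longrightarrow> smooth_on T f"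
  unfolding smooth_on_def using Ck_on_subset by blast

lemma smooth_on_has_derivative:
  "smooth_on S f \<Longrightarrow> x \<in> S \<Longrightarrow> (f has_derivative frechet_derivative f (at x)) (at x)"
  unfolding smooth_on_def using Ck_on_Suc_has_derivative by blast

lemma smooth_on_differentiable: "smooth_on S f \<Longrightarrow> x \<in> S \<Longrightarrow> f differentiable (at x)"
  using smooth_on_has_derivative differentiable_def by blast

lemma smooth_on_continuous: "smooth_on S f \<Longrightarrow> continuous_on S f"
  unfolding smooth_on_def by (metis Ck_on.simps(1))

text \<open>Serves functions whose derivative is more explicit than they are: the logarithm, and the
  potential, which is defined by an integral.\<close>

lemma smooth_on_antiderivative:
  assumes "open S" "\<And>x. x \<in> S \<Longrightarrow> (f has_derivative D x) (at x)"
    "\<And>b. b \<in> Basis \<Longrightarrow> smooth_on S (\<lambda>x. D x b)"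
  shows "smooth_on S f"
proof -
  have "Ck_on (Suc k) S f" for k
    using Ck_on_SucI[OF assms(1,2)] assms(3) unfolding smooth_on_def by blast
  then show ?thesis unfolding smooth_on_def using Ck_on_SucD by blast
qed

lemma smooth_on_const: "smooth_on S (\<lambda>_. c)"
  by (simp add: smooth_on_def Ck_on_const)

lemma smooth_on_bounded_linear:
  "bounded_linear L \<Longrightarrow> open S \<Longrightarrow> smooth_on S f \<Longrightarrow> smooth_on S (\<lambda>x. L (f x))"
  by (simp add: smooth_on_def Ck_on_bounded_linear)

lemma smooth_on_add:
  "open S \<Longrightarrow> smooth_on S f \<Longrightarrow> smooth_on S g \<Longrightarrow> smooth_on S (\<lambda>x. f x + g x)"
  by (simp add: smooth_on_def Ck_on_add)

lemma smooth_on_sum: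
  "open S \<Longrightarrow> (\<And>i. i \<in> I \<Longrightarrow> smooth_on S (f i)) \<Longrightarrow> smooth_on S (\<lambda>x. \<Sum>i\<in>I. f i x)"
  by (simp add: smooth_on_def Ck_on_sum)

lemma smooth_on_minus: "open S \<Longrightarrow> smooth_on S f \<Longrightarrow> smooth_on S (\<lambda>x. - f x)"
  using smooth_on_bounded_linear[OF bounded_linear_minus[OF bounded_linear_ident]] .

lemma smooth_on_diff:
  "open S \<Longrightarrow> smooth_on S f \<Longrightarrow> smooth_on S g \<Longrightarrow> smooth_on S (\<lambda>x. f x - g x)"
  using smooth_on_add[OF _ _ smooth_on_minus, of S f g] by simp

lemma smooth_on_mult:
  fixes f g :: "'e::euclidean_space \<Rightarrow> real"
  shows "open S \<Longrightarrow> smooth_on S f \<Longrightarrow> smooth_on S g \<Longrightarrow> smooth_on S (\<lambda>x. f x * g x)"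
  by (simp add: smooth_on_def Ck_on_mult)

lemma smooth_on_divide_const:
  fixes f :: "'e::euclidean_space \<Rightarrow> real"
  shows "open S \<Longrightarrow> smooth_on S f \<Longrightarrow> smooth_on S (\<lambda>x. f x / c)"
  using smooth_on_mult[OF _ _ smooth_on_const, of S f "1 / c"] by simp

lemma smooth_on_power:
  fixes f :: "'e::euclidean_space \<Rightarrow> real"
  shows "open S \<Longrightarrow> smooth_on S f \<Longrightarrow> smooth_on S (\<lambda>x. f x ^ n)"
  by (induction n) (auto intro: smooth_on_const smooth_on_mult)

lemma smooth_on_powr:
  fixes f :: "'e::euclidean_space \<Rightarrow> real"
  shows "open S \<Longrightarrow> smooth_on S f \<Longrightarrow> (\<And>x. x \<in> S \<Longrightarrow> f x > 0) \<Longrightarrow> smooth_on S (\<lambda>x. f x powr c)"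
  by (simp add: smooth_on_def Ck_on_powr)

lemma smooth_on_ln:
  fixes f :: "'e::euclidean_space \<Rightarrow> real"
  assumes "open S" "smooth_on S f" "\<And>x. x \<in> S \<Longrightarrow> f x > 0"
  shows "smooth_on S (\<lambda>x. ln (f x))"
proof (rule smooth_on_antiderivative[OF assms(1)])
  show "((\<lambda>x. ln (f x)) has_derivative (\<lambda>v. f x powr -1 * frechet_derivative f (at x) v)) (at x)"
    if "x \<in> S" for x
    using has_derivative_ln[OF assms(3)[OF that] smooth_on_has_derivative[OF assms(2) that]]
      assms(3)[OF that] by (simp add: powr_neg_one inverse_eq_divide mult.commute)
  show "smooth_on S (\<lambda>x. f x powr -1 * frechet_derivative f (at x) b)" if "b \<in> Basis" for b
  proof -
    have "smooth_on S (\<lambda>x. frechet_derivative f (at x) b)"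
      using assms(2) that unfolding smooth_on_def by (metis Ck_on.simps(2))
    then show ?thesis by (intro smooth_on_mult smooth_on_powr assms)
  qed
qed

lemma smooth_on_compose_linear:
  fixes L :: "'d::euclidean_space \<Rightarrow> 'e::euclidean_space"
  shows "bounded_linear L \<Longrightarrow> open S \<Longrightarrow> smooth_on S f \<Longrightarrow> smooth_on (L -` S) (\<lambda>x. f (L x))"
  by (simp add: smooth_on_def Ck_on_compose_linear)

lemma smooth_on_ident: "open S \<Longrightarrow> smooth_on S (\<lambda>x. x)"
  by (rule smooth_on_antiderivative[OF _ has_derivative_ident]) (auto intro: smooth_on_const)

lemma smooth_on_component:
  fixes f :: "'e::euclidean_space \<Rightarrow> 'f::euclidean_space^'n"
  shows "open S \<Longrightarrow> smooth_on S f \<Longrightarrow> smooth_on S (\<lambda>x. f x $ k)"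
  by (rule smooth_on_bounded_linear[OF bounded_linear_vec_nth])

lemma smooth_on_vec:
  fixes f :: "'e::euclidean_space \<Rightarrow> 'f::euclidean_space^'n"
  assumes "open S" "\<And>k. smooth_on S (\<lambda>x. f x $ k)"
  shows "smooth_on S f"
proof -
  have "bounded_linear (axis k :: 'f \<Rightarrow> 'f^'n)" for k
    unfolding linear_conv_bounded_linear[symmetric]
    by (rule linearI) (simp_all add: axis_def vec_eq_iff)
  note * = smooth_on_bounded_linear[OF this assms]
  have "smooth_on S (\<lambda>x. \<Sum>k\<in>UNIV. axis k (f x $ k))"
    by (rule smooth_on_sum[OF assms(1) *])
  moreover have "(\<Sum>k\<in>UNIV. axis k (f x $ k)) = f x" for x
    by (simp add: vec_eq_iff axis_def)
  ultimately show ?thesis by simp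
qed

section \<open>Partial derivatives\<close>

lemma axis_Basis: "axis a (1::real) \<in> Basis"
  by simp

lemma smooth_on_pd: "smooth_on S f \<Longrightarrow> smooth_on S (pd a f)"
  unfolding smooth_on_def pd_def[abs_def] using axis_Basis Ck_on.simps(2) by metis

lemma pd_eq: "(f has_derivative D) (at u) \<Longrightarrow> pd a f u = D (axis a 1)"
  by (simp add: pd_def frechet_derivative_eq)

text \<open>Differentiability plays no part in the argument, as \<open>frechet_derivative\<close> is
  chosen from the predicate \<open>has_derivative\<close>, on which functions agreeing near
  \<open>u\<close> coincide.\<close>

lemma pd_cong:
  assumes "open S" "u \<in> S" "\<And>x. x \<in> S \<Longrightarrow> f x = g x"
  shows "pd a f u = pd a g u"
proof -
  have "(f has_derivative D) (at u) \<longleftrightarrow> (g has_derivative D) (at u)" for D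
    using has_derivative_transform_within_open[OF _ assms(1,2)] assms(3) by metis
  then show ?thesis by (simp add: pd_def frechet_derivative_def)
qed

lemma differentiable_has_derivative:
  "f differentiable (at u) \<Longrightarrow> (f has_derivative frechet_derivative f (at u)) (at u)"
  by (simp add: frechet_derivative_works)

lemma pd_const: "pd a (\<lambda>_. c) u = 0"
  by (simp add: pd_def)

lemma pd_add:
  "f differentiable (at u) \<Longrightarrow> g differentiable (at u) \<Longrightarrow>
    pd a (\<lambda>x. f x + g x) u = pd a f u + pd a g u"
  using pd_eq[OF has_derivative_add[OF differentiable_has_derivative differentiable_has_derivative]]
  by (simp add: pd_def)

lemma pd_diff:
  "f differentiable (at u) \<Longrightarrow> g differentiable (at u) \<Longrightarrow>
    pd a (\<lambda>x. f x - g x) u = pd a f u - pd a g u"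
  using pd_eq[OF has_derivative_diff[OF differentiable_has_derivative differentiable_has_derivative]]
  by (simp add: pd_def)

lemma pd_minus: "f differentiable (at u) \<Longrightarrow> pd a (\<lambda>x. - f x) u = - pd a f u"
  using pd_eq[OF has_derivative_minus[OF differentiable_has_derivative]]
  by (simp add: pd_def)

lemma pd_sum:
  "(\<And>i. i \<in> I \<Longrightarrow> f i differentiable (at u)) \<Longrightarrow>
    pd a (\<lambda>x. \<Sum>i\<in>I. f i x) u = (\<Sum>i\<in>I. pd a (f i) u)"
  by (subst pd_eq[OF has_derivative_sum[OF differentiable_has_derivative]]) (auto simp: pd_def)

lemma pd_mult:
  fixes f g :: "real^'n \<Rightarrow> real"
  shows "f differentiable (at u) \<Longrightarrow> g differentiable (at u) \<Longrightarrow>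
    pd a (\<lambda>x. f x * g x) u = pd a f u * g u + f u * pd a g u"
  by (subst pd_eq[OF has_derivative_mult[OF differentiable_has_derivative
          differentiable_has_derivative]]) (auto simp: pd_def)

lemma pd_cmult:
  fixes f :: "real^'n \<Rightarrow> real"
  shows "f differentiable (at u) \<Longrightarrow> pd a (\<lambda>x. c * f x) u = c * pd a f u"
  by (subst pd_mult) (auto simp: pd_const)

lemma pd_divide_const:
  fixes f :: "real^'n \<Rightarrow> real"
  shows "f differentiable (at u) \<Longrightarrow> pd a (\<lambda>x. f x / c) u = pd a f u / c"
  using pd_cmult[of f u a "1 / c"] by simp

text \<open>Logarithmic form: the power itself stays a factor, so that \<open>pd_rad\<close> can
  factor out \<open>rad\<close>.\<close>

lemma pd_powr:
  fixes f :: "real^'n \<Rightarrow> real"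
  assumes "f differentiable (at u)" "f u > 0"
  shows "pd a (\<lambda>x. f x powr c) u = c * f u powr c * (pd a f u / f u)"
  using pd_eq[OF has_derivative_powr_const[OF differentiable_has_derivative[OF assms(1)] assms(2)]]
    assms(2) by (simp add: pd_def powr_diff)

lemma differentiable_powr_const:
  fixes f :: "real^'n \<Rightarrow> real"
  assumes "f differentiable (at u)" "f u > 0"
  shows "(\<lambda>x. f x powr c) differentiable (at u)"
  using has_derivative_powr_const[OF differentiable_has_derivative[OF assms(1)] assms(2)]
  by (auto simp: differentiable_def)

lemma pd_ln:
  fixes f :: "real^'n \<Rightarrow> real"
  assumes "f differentiable (at u)" "f u > 0"
  shows "pd a (\<lambda>x. ln (f x)) u = pd a f u / f u"
  using pd_eq[OF has_derivative_ln[OF assms(2) differentiable_has_derivative[OF assms(1)]]]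
  by (simp add: pd_def divide_inverse mult.commute)

lemma pd_component:
  fixes f :: "real^'m \<Rightarrow> 'f::real_normed_vector^'n"
  assumes "f differentiable (at u)"
  shows "pd a (\<lambda>x. f x $ k) u = pd a f u $ k"
  using pd_eq[OF bounded_linear.has_derivative[OF bounded_linear_vec_nth
        differentiable_has_derivative[OF assms]]]
  by (simp add: pd_def)

lemma differentiable_component:
  fixes f :: "real^'m \<Rightarrow> 'f::real_normed_vector^'n"
  shows "f differentiable (at u) \<Longrightarrow> (\<lambda>x. f x $ k) differentiable (at u)"
  using bounded_linear.has_derivative[OF bounded_linear_vec_nth] unfolding differentiable_def by blast

lemma frechet_derivative_pd:
  fixes f :: "real^'m \<Rightarrow> 'f::real_normed_vector"
  assumes "f differentiable (at u)"
  shows "frechet_derivative f (at u) v = (\<Sum>k\<in>UNIV. v $ k *\<^sub>R pd k f u)"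
proof -
  have "linear (frechet_derivative f (at u))"
    using assms linear_frechet_derivative by blast
  then have "frechet_derivative f (at u) (\<Sum>k\<in>UNIV. v $ k *\<^sub>R axis k 1)
      = (\<Sum>k\<in>UNIV. v $ k *\<^sub>R pd k f u)"
    by (simp add: linear_sum linear_cmul pd_def)
  then show ?thesis using basis_expansion[of v] by (simp add: scalar_mult_eq_scaleR)
qed

lemma pd_compose:
  fixes f :: "real^'m \<Rightarrow> real" and T :: "real^'n \<Rightarrow> real^'m"
  assumes "T differentiable (at u)" "f differentiable (at (T u))"
  shows "pd a (\<lambda>x. f (T x)) u = (\<Sum>r\<in>UNIV. pd r f (T u) * pd a T u $ r)"
  unfolding pd_eq[OF has_derivative_compose[OF differentiable_has_derivative[OF assms(1)]
        differentiable_has_derivative[OF assms(2)]]] frechet_derivative_pd[OF assms(2)]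
  by (simp add: pd_def[of a] mult.commute)

section \<open>Symmetry of second partial derivatives\<close>

lemma mean_value_axis:
  fixes f :: "real^'n \<Rightarrow> real"
  assumes "0 < h" "\<And>t. 0 \<le> t \<Longrightarrow> t \<le> h \<Longrightarrow> f differentiable (at (x + t *\<^sub>R axis a 1))"
  shows "\<exists>t. 0 < t \<and> t < h \<and> f (x + h *\<^sub>R axis a 1) - f x = h * pd a f (x + t *\<^sub>R axis a 1)"
proof -
  let ?g = "\<lambda>t. f (x + t *\<^sub>R axis a 1)"
  have "DERIV ?g t :> pd a f (x + t *\<^sub>R axis a 1)" if "0 \<le> t" "t \<le> h" for t
  proof -
    have "((\<lambda>t. x + t *\<^sub>R axis a (1::real)) has_derivative (\<lambda>s. s *\<^sub>R axis a 1)) (at t)"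
      by (auto intro!: derivative_eq_intros)
    from has_derivative_compose[OF this differentiable_has_derivative[OF assms(2)[OF that]]]
    show ?thesis
      unfolding has_field_derivative_def
      using linear_frechet_derivative[OF assms(2)[OF that]]
      by (simp add: linear_cmul pd_def mult_commute_abs)
  qed
  from MVT2[OF assms(1) this] show ?thesis by (force simp: algebra_simps)
qed

text \<open>The mean value theorem along \<open>a\<close>, applied to the difference in direction
  \<open>b\<close>, and then along \<open>b\<close>, applied to the partial derivative in direction
  \<open>a\<close>, leaves a single value of the mixed derivative. The margin
  \<open>2 * h < d\<close> keeps the whole parallelogram in the ball.\<close>

lemma second_difference:
  fixes f :: "real^'n \<Rightarrow> real"
  assumes "smooth_on S f" "ball u d \<subseteq> S" "0 < h" "2 * h < d"
  shows "\<exists>x. dist x u < d \<and>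
    f (u + h *\<^sub>R axis a 1 + h *\<^sub>R axis b 1) - f (u + h *\<^sub>R axis a 1) - f (u + h *\<^sub>R axis b 1) + f u
      = h * (h * pd b (pd a f) x)"
proof -
  have inS: "u + s *\<^sub>R axis a 1 + t *\<^sub>R axis b 1 \<in> S" "dist (u + s *\<^sub>R axis a 1 + t *\<^sub>R axis b 1) u < d"
    if "0 \<le> s" "s \<le> h" "0 \<le> t" "t \<le> h" for s t
  proof -
    have "norm (s *\<^sub>R axis a 1 + t *\<^sub>R axis b (1::real)) \<le> s + t"
      using that norm_triangle_ineq[of "s *\<^sub>R axis a 1" "t *\<^sub>R axis b (1::real)"] by simp
    then show "dist (u + s *\<^sub>R axis a 1 + t *\<^sub>R axis b 1) u < d"
      using that assms(4) by (simp add: dist_norm add.assoc)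
    then show "u + s *\<^sub>R axis a 1 + t *\<^sub>R axis b 1 \<in> S"
      using assms(2) by (auto simp: dist_commute)
  qed
  note df = smooth_on_differentiable[OF assms(1)]
  note dp = smooth_on_differentiable[OF smooth_on_pd[OF assms(1)]]
  let ?g = "\<lambda>x. f (x + h *\<^sub>R axis b 1) - f x"
  have sh: "((\<lambda>x. x + h *\<^sub>R axis b 1) has_derivative (\<lambda>v. v)) (at x)" for x :: "real^'n"
    by (auto intro!: derivative_eq_intros)
  have shifted: "((\<lambda>x. f (x + h *\<^sub>R axis b 1)) has_derivative
      frechet_derivative f (at (x + h *\<^sub>R axis b 1))) (at x)"
    if "x + h *\<^sub>R axis b 1 \<in> S" for x
    using has_derivative_compose[OF sh differentiable_has_derivative[OF df[OF that]]] by simp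
  have g: "(?g has_derivative (\<lambda>v. frechet_derivative f (at (x + h *\<^sub>R axis b 1)) v
      - frechet_derivative f (at x) v)) (at x)"
    if "x + h *\<^sub>R axis b 1 \<in> S" "x \<in> S" for x
    by (rule has_derivative_diff[OF shifted[OF that(1)] differentiable_has_derivative[OF df[OF that(2)]]])
  have "?g differentiable (at (u + t *\<^sub>R axis a 1))" if "0 \<le> t" "t \<le> h" for t
    using g[of "u + t *\<^sub>R axis a 1"] inS(1)[of t h] inS(1)[of t 0] that assms(3)
    by (auto simp: differentiable_def)
  from mean_value_axis[OF assms(3) this]
  obtain s where s: "0 < s" "s < h"
    "?g (u + h *\<^sub>R axis a 1) - ?g u = h * pd a ?g (u + s *\<^sub>R axis a 1)" by blast
  have pg: "pd a ?g (u + s *\<^sub>R axis a 1)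
      = pd a f (u + s *\<^sub>R axis a 1 + h *\<^sub>R axis b 1) - pd a f (u + s *\<^sub>R axis a 1)"
    using pd_eq[OF g] inS(1)[of s h] inS(1)[of s 0] s assms(3) by (simp add: pd_def)
  have "pd a f differentiable (at (u + s *\<^sub>R axis a 1 + t *\<^sub>R axis b 1))" if "0 \<le> t" "t \<le> h" for t
    by (rule dp[OF inS(1)]) (use that s in auto)
  from mean_value_axis[OF assms(3) this]
  obtain t where t: "0 < t" "t < h"
    "pd a f (u + s *\<^sub>R axis a 1 + h *\<^sub>R axis b 1) - pd a f (u + s *\<^sub>R axis a 1)
      = h * pd b (pd a f) (u + s *\<^sub>R axis a 1 + t *\<^sub>R axis b 1)" by blast
  show ?thesis
    using s pg t inS(2)[of s t] by (intro exI[of _ "u + s *\<^sub>R axis a 1 + t *\<^sub>R axis b 1"]) auto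
qed

text \<open>The second difference is symmetric in the two directions, so the two mixed derivatives
  share values at points arbitrarily close to \<open>u\<close>; continuity brings this to
  \<open>u\<close> itself.\<close>

lemma pd_commute:
  fixes f :: "real^'n \<Rightarrow> real"
  assumes "open S" "smooth_on S f" "u \<in> S"
  shows "pd a (pd b f) u = pd b (pd a f) u"
proof (rule ccontr)
  assume ne: "\<not> ?thesis"
  let ?F = "pd a (pd b f)" and ?G = "pd b (pd a f)"
  let ?e = "\<bar>?F u - ?G u\<bar> / 2"
  have "isCont ?F u" "isCont ?G u"
    using smooth_on_continuous[OF smooth_on_pd[OF smooth_on_pd[OF assms(2)]]]
      continuous_on_eq_continuous_at assms by blast+
  moreover have e: "?e > 0" using ne by simp
  ultimately obtain d1 d2 where d: "d1 > 0" "d2 > 0"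
      "\<And>x. dist x u < d1 \<Longrightarrow> dist (?F x) (?F u) < ?e"
      "\<And>x. dist x u < d2 \<Longrightarrow> dist (?G x) (?G u) < ?e"
    unfolding continuous_at_eps_delta by metis
  obtain d3 where d3: "d3 > 0" "ball u d3 \<subseteq> S" using assms(1,3) open_contains_ball by metis
  let ?d = "min d1 (min d2 d3)"
  have D: "?d > 0" "ball u ?d \<subseteq> S" using d d3 by auto
  define h where "h = ?d / 3"
  have h: "h > 0" "2 * h < ?d" using D by (auto simp: h_def)
  obtain x y where "dist x u < ?d" "dist y u < ?d" "h * (h * ?G x) = h * (h * ?F y)"
    using second_difference[OF assms(2) D(2) h, of a b] second_difference[OF assms(2) D(2) h, of b a]
    by (smt (verit) add.commute add.left_commute)
  then have "?G x = ?F y" "dist (?F y) (?F u) < ?e" "dist (?G x) (?G u) < ?e"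
    using h(1) d(3)[of y] d(4)[of x] by simp_all
  then show False unfolding dist_real_def by (auto simp: abs_if split: if_splits)
qed

section \<open>Coordinate changes\<close>

lemma pd_ident: "pd a (\<lambda>x. x) u = axis a 1"
  by (simp add: pd_def)

lemma trans_jac_nth: "trans_jac A i j u $ r $ k = pd k (transition A i j) u $ r"
  by (simp add: trans_jac_def jacobian_def matrix_def pd_def)

lemma transition_coord:
  "inj_on (coord A i) (chart_dom A i) \<Longrightarrow> x \<in> chart_dom A i \<Longrightarrow>
    transition A i j (coord A i x) = coord A j x"
  by (simp add: transition_def)

lemma local_rep_coord:
  "inj_on (coord A i) (chart_dom A i) \<Longrightarrow> x \<in> chart_dom A i \<Longrightarrow>
    local_rep A i f (coord A i x) = f x"
  by (simp add: local_rep_def)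

lemma coord_in_img: "x \<in> chart_dom A i \<Longrightarrow> x \<in> W \<Longrightarrow> coord A i x \<in> img A W i"
  by (auto simp: img_def)

lemma img_Int:
  "inj_on (coord A i) (chart_dom A i) \<Longrightarrow> img A (V \<inter> W) i = img A V i \<inter> img A W i"
  unfolding img_def inj_on_def by blast

lemma img_carrier: "i \<in> chart_ids A \<Longrightarrow> img A (carrier A) i = coord A i ` chart_dom A i"
  unfolding img_def carrier_def by blast

lemma smooth_atlas_inj: "smooth_atlas A \<Longrightarrow> i \<in> chart_ids A \<Longrightarrow> inj_on (coord A i) (chart_dom A i)"
  by (simp add: smooth_atlas_def)

lemma smooth_atlas_open_overlap:
  "smooth_atlas A \<Longrightarrow> i \<in> chart_ids A \<Longrightarrow> j \<in> chart_ids A \<Longrightarrow> open (img A (chart_dom A j) i)"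
  by (simp add: smooth_atlas_def)

lemma smooth_atlas_open_carrier:
  "smooth_atlas A \<Longrightarrow> i \<in> chart_ids A \<Longrightarrow> open (img A (carrier A) i)"
  by (simp add: smooth_atlas_def img_carrier)

lemma smooth_on_transition:
  "smooth_atlas A \<Longrightarrow> i \<in> chart_ids A \<Longrightarrow> j \<in> chart_ids A \<Longrightarrow>
    smooth_on (img A (chart_dom A j) i) (transition A i j)"
  by (simp add: smooth_atlas_def)

lemma smooth_on_trans_jac:
  assumes "smooth_atlas A" "i \<in> chart_ids A" "j \<in> chart_ids A"
  shows "smooth_on (img A (chart_dom A j) i) (\<lambda>u. trans_jac A i j u $ r $ k)"
  unfolding trans_jac_nth using assms
  by (intro smooth_on_component smooth_on_pd smooth_on_transition smooth_atlas_open_overlap)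

lemma trans_jac_self:
  assumes "smooth_atlas A" "i \<in> chart_ids A" "x \<in> chart_dom A i"
  shows "trans_jac A i i (coord A i x) = mat 1"
proof -
  have "pd k (transition A i i) (coord A i x) = pd k (\<lambda>w. w) (coord A i x)" for k
    by (rule pd_cong[OF smooth_atlas_open_overlap[OF assms(1,2,2)]])
      (use assms coord_in_img transition_coord[OF smooth_atlas_inj[OF assms(1,2)]]
        in \<open>auto simp: img_def\<close>)
  then show ?thesis
    by (simp add: vec_eq_iff trans_jac_nth pd_ident axis_def mat_def)
qed

lemma trans_jac_cocycle:
  assumes A: "smooth_atlas A" and i: "i \<in> chart_ids A" and j: "j \<in> chart_ids A"
    and k: "k \<in> chart_ids A"
    and x: "x \<in> chart_dom A i" "x \<in> chart_dom A j" "x \<in> chart_dom A k"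
  shows "trans_jac A i k (coord A i x) =
    trans_jac A j k (coord A j x) ** trans_jac A i j (coord A i x)"
proof -
  note inj = smooth_atlas_inj[OF A]
  let ?T = "transition A i j" and ?S = "transition A j k"
  let ?N = "img A (chart_dom A j) i \<inter> img A (chart_dom A k) i"
  have u: "coord A i x \<in> ?N" "coord A j x \<in> img A (chart_dom A k) j"
    using coord_in_img[OF x(1,2)] coord_in_img[OF x(1,3)] coord_in_img[OF x(2,3)] by blast+
  have N: "open ?N" using smooth_atlas_open_overlap[OF A i] j k by blast
  have Tu: "?T (coord A i x) = coord A j x" by (rule transition_coord[OF inj[OF i] x(1)])
  have dT: "?T differentiable (at (coord A i x))"
    using smooth_on_differentiable[OF smooth_on_transition[OF A i j]] u by blast
  have dS: "?S differentiable (at (coord A j x))"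
    using smooth_on_differentiable[OF smooth_on_transition[OF A j k]] u by blast
  have eq: "transition A i k w = ?S (?T w)" if "w \<in> ?N" for w
  proof -
    have "w \<in> img A (chart_dom A j \<inter> chart_dom A k) i"
      using that img_Int[OF inj[OF i]] by blast
    then obtain y where "y \<in> chart_dom A i" "y \<in> chart_dom A j" "w = coord A i y"
      by (auto simp: img_def)
    then show ?thesis
      by (simp add: transition_coord[OF inj[OF i]] transition_coord[OF inj[OF j]])
  qed
  have dik: "transition A i k differentiable (at (coord A i x))"
    using smooth_on_differentiable[OF smooth_on_transition[OF A i k]] u by blast
  have "pd c (transition A i k) (coord A i x) $ r =
      (\<Sum>q\<in>UNIV. pd q ?S (coord A j x) $ r * pd c ?T (coord A i x) $ q)" for c r
  proof -
    have "pd c (transition A i k) (coord A i x) $ r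
        = pd c (\<lambda>w. transition A i k w $ r) (coord A i x)"
      by (rule pd_component[OF dik, symmetric])
    also have "\<dots> = pd c (\<lambda>w. ?S (?T w) $ r) (coord A i x)"
      by (rule pd_cong[OF N u(1)]) (simp add: eq)
    also have "\<dots> = (\<Sum>q\<in>UNIV. pd q (\<lambda>v. ?S v $ r) (coord A j x) * pd c ?T (coord A i x) $ q)"
      using pd_compose[OF dT, of "\<lambda>v. ?S v $ r"] differentiable_component[OF dS]
      by (simp add: Tu)
    finally show ?thesis by (simp add: pd_component[OF dS])
  qed
  then show ?thesis by (simp add: vec_eq_iff trans_jac_nth matrix_matrix_mult_def)
qed

text \<open>By the cocycle law for the way from \<open>i\<close> to \<open>j\<close> and back, the
  two determinants are inverse to each other.\<close>

lemma det_trans_jac_nonzero: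
  assumes "smooth_atlas A" "i \<in> chart_ids A" "j \<in> chart_ids A" "x \<in> chart_dom A i" "x \<in> chart_dom A j"
  shows "det (trans_jac A i j (coord A i x)) \<noteq> 0"
proof -
  have "det (trans_jac A j i (coord A j x)) * det (trans_jac A i j (coord A i x)) = 1"
    using trans_jac_cocycle[OF assms(1,2,3,2,4,5,4)] trans_jac_self[OF assms(1,2,4)]
    by (metis det_I det_mul)
  then show ?thesis by auto
qed

section \<open>Hessians with respect to an affine connection\<close>

lemma affine_connection_smooth:
  assumes "affine_connection A \<Gamma>" "i \<in> chart_ids A" "open (img A (carrier A) i)"
  shows "smooth_on (img A (carrier A) i) (\<lambda>u. \<Gamma> i u $ a $ b $ k)"
  using assms by (intro smooth_on_component) (auto simp: affine_connection_def)

lemma hess_nth: "hess G f u $ a $ b = pd a (pd b f) u - (\<Sum>k\<in>UNIV. G u $ a $ b $ k * pd k f u)"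
  by (simp add: hess_def)

lemma hess_cong:
  assumes S: "open S" "u \<in> S" and eq: "\<And>x. x \<in> S \<Longrightarrow> f x = g x"
  shows "hess G f u = hess G g u"
proof -
  have p: "pd b f x = pd b g x" if "x \<in> S" for b x
    by (rule pd_cong[OF S(1) that eq])
  have "pd a (pd b f) u = pd a (pd b g) u" for a b
    by (rule pd_cong[OF S p])
  then show ?thesis using p[OF S(2)] by (simp add: hess_def)
qed

text \<open>The chain rule produces second derivatives of the coordinate change; they are the
  inhomogeneous term in the transformation law of the connection, and cancel against it.\<close>

lemma hess_transform:
  assumes A: "smooth_atlas A" and \<Gamma>: "affine_connection A \<Gamma>"
    and i: "i \<in> chart_ids A" and j: "j \<in> chart_ids A"
    and W: "open (img A W i)" and f: "smooth_on (img A W j) (local_rep A j \<phi>)"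
    and u: "u \<in> img A (W \<inter> chart_dom A j) i"
  shows "hess_tensor A \<Gamma> \<phi> i u = transpose (trans_jac A i j u) **
    hess_tensor A \<Gamma> \<phi> j (transition A i j u) ** trans_jac A i j u"
proof -
  note inj = smooth_atlas_inj[OF A]
  let ?T = "transition A i j" and ?f = "local_rep A j \<phi>"
  let ?J = "\<lambda>w r c. trans_jac A i j w $ r $ c"
  let ?N = "img A (W \<inter> chart_dom A j) i"
  have N: "open ?N" using W smooth_atlas_open_overlap[OF A i j] by (simp add: img_Int[OF inj[OF i]] open_Int)
  have mem: "?T w \<in> img A W j" "local_rep A i \<phi> w = ?f (?T w)" "w \<in> img A (chart_dom A j) i"
    if "w \<in> ?N" for w
    using that i j inj by (auto simp: img_def transition_coord local_rep_coord)
  have dT: "?T differentiable (at w)" if "w \<in> ?N" for w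
    using smooth_on_differentiable[OF smooth_on_transition[OF A i j]] mem that by blast
  have df: "?f differentiable (at (?T w))" if "w \<in> ?N" for w
    using smooth_on_differentiable[OF f] mem that by blast
  have dpf: "pd r ?f differentiable (at (?T w))" if "w \<in> ?N" for r w
    using smooth_on_differentiable[OF smooth_on_pd[OF f]] mem that by blast
  have dpfT: "(\<lambda>w. pd r ?f (?T w)) differentiable (at u)" for r
    using differentiable_chain_at[OF dT[OF u] dpf[OF u]] by (simp add: o_def)
  have dJ: "(\<lambda>w. ?J w r b) differentiable (at u)" for r b
    using smooth_on_differentiable[OF smooth_on_trans_jac[OF A i j]] mem(3)[OF u] by blast
  have p1: "pd b (local_rep A i \<phi>) w = (\<Sum>r\<in>UNIV. pd r ?f (?T w) * ?J w r b)" if "w \<in> ?N" for b w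
    using pd_cong[OF N that mem(2), where a = b] pd_compose[OF dT[OF that] df[OF that]]
    by (simp add: trans_jac_nth)
  have p2: "pd a (pd b (local_rep A i \<phi>)) u =
      (\<Sum>r\<in>UNIV. (\<Sum>q\<in>UNIV. pd q (pd r ?f) (?T u) * ?J u q a) * ?J u r b
        + pd r ?f (?T u) * pd a (\<lambda>w. ?J w r b) u)" for a b
  proof -
    have "pd a (pd b (local_rep A i \<phi>)) u = pd a (\<lambda>w. \<Sum>r\<in>UNIV. pd r ?f (?T w) * ?J w r b) u"
      by (rule pd_cong[OF N u p1])
    also have "\<dots> = (\<Sum>r\<in>UNIV. pd a (\<lambda>w. pd r ?f (?T w) * ?J w r b) u)"
      by (rule pd_sum) (intro differentiable_mult dpfT dJ)
    also have "\<dots> = (\<Sum>r\<in>UNIV. pd a (\<lambda>w. pd r ?f (?T w)) u * ?J u r b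
        + pd r ?f (?T u) * pd a (\<lambda>w. ?J w r b) u)"
      by (simp add: pd_mult dpfT dJ)
    finally show ?thesis by (simp add: pd_compose[OF dT[OF u] dpf[OF u]] trans_jac_nth)
  qed
  \<comment> \<open>The transformation law contracted with the differential of the function; the
    first summand on the right is the one that cancels in \<open>p2\<close>.\<close>
  have conn: "(\<Sum>k\<in>UNIV. \<Gamma> i u $ a $ b $ k * (\<Sum>r\<in>UNIV. pd r ?f (?T u) * ?J u r k)) =
      (\<Sum>r\<in>UNIV. pd r ?f (?T u) * (pd a (\<lambda>w. ?J w r b) u +
        (\<Sum>p\<in>UNIV. \<Sum>q\<in>UNIV. \<Gamma> j (?T u) $ p $ q $ r * ?J u p a * ?J u q b)))" for a b
  proof -
    have "(\<Sum>k\<in>UNIV. \<Gamma> i u $ a $ b $ k * (\<Sum>r\<in>UNIV. pd r ?f (?T u) * ?J u r k)) =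
      (\<Sum>r\<in>UNIV. pd r ?f (?T u) * (\<Sum>k\<in>UNIV. \<Gamma> i u $ a $ b $ k * ?J u r k))"
      unfolding sum_distrib_left by (subst sum.swap) (simp add: algebra_simps)
    then show ?thesis using \<Gamma> i j mem(3)[OF u] unfolding affine_connection_def by simp
  qed
  have "hess_tensor A \<Gamma> \<phi> i u $ a $ b =
     (\<Sum>r\<in>UNIV. \<Sum>q\<in>UNIV. ?J u q a * hess_tensor A \<Gamma> \<phi> j (?T u) $ q $ r * ?J u r b)" for a b
  proof -
    have "(\<Sum>r\<in>UNIV. \<Sum>q\<in>UNIV. ?J u q a * (\<Sum>k\<in>UNIV. \<Gamma> j (?T u) $ q $ r $ k * pd k ?f (?T u)) * ?J u r b)
      = (\<Sum>r\<in>UNIV. \<Sum>q\<in>UNIV. \<Sum>k\<in>UNIV. pd k ?f (?T u) * (\<Gamma> j (?T u) $ q $ r $ k * ?J u q a * ?J u r b))"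
      by (simp add: sum_distrib_left sum_distrib_right algebra_simps)
    also have "\<dots> = (\<Sum>q\<in>UNIV. \<Sum>r\<in>UNIV. \<Sum>k\<in>UNIV. pd k ?f (?T u) * (\<Gamma> j (?T u) $ q $ r $ k * ?J u q a * ?J u r b))"
      by (rule sum.swap)
    also have "\<dots> = (\<Sum>q\<in>UNIV. \<Sum>k\<in>UNIV. \<Sum>r\<in>UNIV. pd k ?f (?T u) * (\<Gamma> j (?T u) $ q $ r $ k * ?J u q a * ?J u r b))"
      by (intro sum.cong refl sum.swap)
    also have "\<dots> = (\<Sum>k\<in>UNIV. \<Sum>q\<in>UNIV. \<Sum>r\<in>UNIV. pd k ?f (?T u) * (\<Gamma> j (?T u) $ q $ r $ k * ?J u q a * ?J u r b))"
      by (rule sum.swap)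
    finally have s: "(\<Sum>r\<in>UNIV. \<Sum>q\<in>UNIV. ?J u q a * (\<Sum>k\<in>UNIV. \<Gamma> j (?T u) $ q $ r $ k * pd k ?f (?T u)) * ?J u r b)
      = (\<Sum>k\<in>UNIV. \<Sum>q\<in>UNIV. \<Sum>r\<in>UNIV. pd k ?f (?T u) * (\<Gamma> j (?T u) $ q $ r $ k * ?J u q a * ?J u r b))" .
    have "(\<Sum>r\<in>UNIV. \<Sum>q\<in>UNIV. ?J u q a * hess_tensor A \<Gamma> \<phi> j (?T u) $ q $ r * ?J u r b) =
      (\<Sum>r\<in>UNIV. \<Sum>q\<in>UNIV. ?J u q a * pd q (pd r ?f) (?T u) * ?J u r b)
      - (\<Sum>r\<in>UNIV. \<Sum>q\<in>UNIV. ?J u q a * (\<Sum>k\<in>UNIV. \<Gamma> j (?T u) $ q $ r $ k * pd k ?f (?T u)) * ?J u r b)"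
      by (simp add: hess_tensor_def hess_nth right_diff_distrib left_diff_distrib sum_subtractf)
    moreover have "hess_tensor A \<Gamma> \<phi> i u $ a $ b =
      (\<Sum>r\<in>UNIV. (\<Sum>q\<in>UNIV. pd q (pd r ?f) (?T u) * ?J u q a) * ?J u r b
        + pd r ?f (?T u) * pd a (\<lambda>w. ?J w r b) u)
      - (\<Sum>r\<in>UNIV. pd r ?f (?T u) * (pd a (\<lambda>w. ?J w r b) u +
        (\<Sum>p\<in>UNIV. \<Sum>q\<in>UNIV. \<Gamma> j (?T u) $ p $ q $ r * ?J u p a * ?J u q b)))"
      unfolding hess_tensor_def hess_nth p1[OF u] p2 conn ..
    ultimately show ?thesis
      unfolding s
      by (simp add: sum.distrib distrib_left sum_distrib_left sum_distrib_right mult.assoc mult.left_commute)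
  qed
  then show ?thesis
    by (simp add: vec_eq_iff matrix_matrix_mult_def transpose_def sum_distrib_right)
qed

lemma smooth_on_hess:
  fixes G :: "'n::finite christoffel"
  assumes "open S" "\<And>a b k. smooth_on S (\<lambda>u. G u $ a $ b $ k)" "smooth_on S f"
  shows "smooth_on S (hess G f)"
  using assms(2,3)
  by (intro smooth_on_vec[OF assms(1)])
    (simp add: hess_nth, intro smooth_on_diff smooth_on_sum smooth_on_mult smooth_on_pd assms(1))

text \<open>Symmetry comes from vanishing torsion and \<open>pd_commute\<close>, tensoriality from
  \<open>hess_transform\<close>; what remains to be computed in charts is the determinant.\<close>

lemma metric_on_hess_tensor:
  assumes A: "smooth_atlas A" and \<Gamma>: "affine_connection A \<Gamma>" "torsion_free A \<Gamma>"
    and W: "openin (manifold_topology A) W" and \<phi>: "smooth_fun A W \<phi>"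
    and det: "\<And>i u. i \<in> chart_ids A \<Longrightarrow> u \<in> img A W i \<Longrightarrow> det (hess_tensor A \<Gamma> \<phi> i u) \<noteq> 0"
  shows "metric_on A W (hess_tensor A \<Gamma> \<phi>)"
proof -
  have oW: "W \<subseteq> carrier A" "open (img A W i)" if "i \<in> chart_ids A" for i
    using W that by (auto simp: openin_manifold_topology[OF A])
  have f: "smooth_on (img A W i) (local_rep A i \<phi>)" if "i \<in> chart_ids A" for i
    using \<phi> that by (simp add: smooth_fun_def)
  have sub: "img A W i \<subseteq> img A (carrier A) i" if "i \<in> chart_ids A" for i
    using oW(1)[OF that] by (auto simp: img_def)
  have "smooth_on (img A W i) (hess_tensor A \<Gamma> \<phi> i)" if i: "i \<in> chart_ids A" for i
    unfolding hess_tensor_def[abs_def] using oW(2)[OF i] f[OF i]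
      smooth_on_subset[OF affine_connection_smooth[OF \<Gamma>(1) i smooth_atlas_open_carrier[OF A i]] sub[OF i]]
    by (intro smooth_on_hess)
  moreover have "transpose (hess_tensor A \<Gamma> \<phi> i u) = hess_tensor A \<Gamma> \<phi> i u"
    if i: "i \<in> chart_ids A" and u: "u \<in> img A W i" for i u
    using \<Gamma>(2) i sub[OF i] u pd_commute[OF oW(2)[OF i] f[OF i] u]
    by (simp add: vec_eq_iff transpose_def hess_tensor_def hess_nth torsion_free_def subset_iff)
  ultimately show ?thesis
    using det hess_transform[OF A \<Gamma>(1) _ _ oW(2) f] by (simp add: metric_on_def)
qed

section \<open>Coordinates on the cube root bundle\<close>

text \<open>Splits the indices of the bundle into base directions \<open>hidx a\<close> and the
  fibre direction \<open>3\<close>, so that component formulas can be stated for all base directions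
  at once.\<close>

definition hidx :: "2 \<Rightarrow> 3" where
  "hidx a = (if a = 1 then 1 else 2)"

lemma hidx_simps [simp]: "hidx 1 = 1" "hidx 2 = 2"
  by (simp_all add: hidx_def)

lemma hidx_neq_3 [simp]: "hidx a \<noteq> 3" "3 \<noteq> hidx a"
  by (simp_all add: hidx_def)

lemma hidx_eq [simp]: "hidx a = hidx b \<longleftrightarrow> a = b"
  using exhaust_2[of a] exhaust_2[of b] by auto

lemma all_hidx: "(\<forall>i. P i) \<longleftrightarrow> (\<forall>a. P (hidx a)) \<and> P 3"
  by (simp add: forall_3 forall_2)

lemma hidx_cases: obtains a where "i = hidx a" | "i = 3"
  using exhaust_3[of i] hidx_simps by metis

lemma sum_hidx: "(\<Sum>i\<in>UNIV. f i) = (\<Sum>a\<in>UNIV. f (hidx a)) + f 3"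
  by (simp add: sum_3 sum_2 add.assoc)

lemma base_pt_nth: "base_pt p $ a = p $ hidx a"
  using exhaust_2[of a] by (auto simp: base_pt_def)

lemma bounded_linear_base_pt: "bounded_linear base_pt"
  unfolding linear_conv_bounded_linear[symmetric]
  by (rule linearI) (simp_all add: vec_eq_iff base_pt_nth)

lemma open_hat_region:
  assumes "open X"
  shows "open {p. base_pt p \<in> X \<and> p $ 3 \<noteq> 0}"
proof -
  have "open (base_pt -` X \<inter> {p. p $ 3 \<noteq> 0})"
    using open_vimage[OF assms linear_continuous_on[OF bounded_linear_base_pt]]
    by (intro open_Int open_Collect_neq) (auto intro!: continuous_intros)
  then show ?thesis by (simp add: vimage_def Int_def)
qed

lemma smooth_on_compose_base_pt:
  fixes f :: "real^2 \<Rightarrow> 'f::real_normed_vector"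
  assumes "open X" "smooth_on X f"
  shows "smooth_on {p. base_pt p \<in> X \<and> p $ 3 \<noteq> 0} (\<lambda>p. f (base_pt p))"
  by (rule smooth_on_subset[OF smooth_on_compose_linear[OF bounded_linear_base_pt assms]]) auto

lemma base_pt_axis [simp]: "base_pt (axis (hidx a) 1) = axis a 1" "base_pt (axis 3 1) = 0"
  by (simp_all add: vec_eq_iff base_pt_nth axis_def)

lemma base_pt_has_derivative:
  assumes "f differentiable (at (base_pt p))"
  shows "((\<lambda>p. f (base_pt p)) has_derivative (\<lambda>v. frechet_derivative f (at (base_pt p)) (base_pt v))) (at p)"
  using has_derivative_compose[OF bounded_linear_imp_has_derivative[OF bounded_linear_base_pt]
      differentiable_has_derivative[OF assms]] .

lemma differentiable_base_pt:
  "f differentiable (at (base_pt p)) \<Longrightarrow> (\<lambda>p. f (base_pt p)) differentiable (at p)"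
  using base_pt_has_derivative unfolding differentiable_def by blast

lemma pd_base_pt:
  assumes "f differentiable (at (base_pt p))"
  shows "pd (hidx a) (\<lambda>p. f (base_pt p)) p = pd a f (base_pt p)"
    and "pd 3 (\<lambda>p. f (base_pt p)) p = 0"
  using linear_frechet_derivative[OF assms]
  unfolding pd_eq[OF base_pt_has_derivative[OF assms]] by (simp_all add: pd_def linear_0)

lemma has_derivative_fibre: "((\<lambda>p. p $ 3) has_derivative (\<lambda>v. v $ 3)) (at (p::real^3))"
  by (rule bounded_linear_imp_has_derivative[OF bounded_linear_vec_nth])

lemma differentiable_fibre: "(\<lambda>p::real^3. p $ 3) differentiable (at p)"
  using has_derivative_fibre unfolding differentiable_def by blast

lemma pd_fibre: "pd i (\<lambda>p. p $ 3) (p::real^3) = (if i = 3 then 1 else 0)"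
  by (simp add: pd_eq[OF has_derivative_fibre] axis_def)

lemma inverse_fibre_has_derivative:
  "p $ 3 \<noteq> 0 \<Longrightarrow> ((\<lambda>p. 1 / p $ 3) has_derivative (\<lambda>v. - v $ 3 / (p $ 3)\<^sup>2)) (at (p::real^3))"
  by (rule has_derivative_eq_rhs[OF has_derivative_divide[OF has_derivative_const has_derivative_fibre]])
    (auto simp: power2_eq_square field_simps)

lemma differentiable_inverse_fibre:
  "p $ 3 \<noteq> 0 \<Longrightarrow> (\<lambda>p. 1 / p $ 3) differentiable (at (p::real^3))"
  using inverse_fibre_has_derivative unfolding differentiable_def by blast

lemma pd_inverse_fibre:
  "p $ 3 \<noteq> 0 \<Longrightarrow> pd i (\<lambda>p. 1 / p $ 3) (p::real^3) = (if i = 3 then - 1 / (p $ 3)\<^sup>2 else 0)"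
  by (simp add: pd_eq[OF inverse_fibre_has_derivative] axis_def)

lemma euler_field_nth: "euler_field p $ hidx a = 0" "euler_field p $ 3 = p $ 3"
  using exhaust_2[of a] by (auto simp: euler_field_def)

lemma hor_lift_nth:
  "hor_lift G X p $ hidx a = X (base_pt p) $ a"
  "hor_lift G X p $ 3 = p $ 3 / 3 * (\<Sum>a\<in>UNIV. conn_trace G a (base_pt p) * X (base_pt p) $ a)"
  using exhaust_2[of a] by (auto simp: hor_lift_def Let_def)

text \<open>The curvature is skew in its first two indices, and in dimension two this leaves one
  independent pair; the Ricci trace then already contains every component.\<close>

lemma curvature_surface:
  fixes G :: "2 christoffel"
  shows "curvature G a b c d u = (if a = d then ricci G b c u else 0) - (if b = d then ricci G a c u else 0)"
proof -
  have "\<forall>a b d. curvature G a b c d u = (if a = d then ricci G b c u else 0) - (if b = d then ricci G a c u else 0)"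
    by (simp add: forall_2 ricci_def sum_2 curvature_def)
  then show ?thesis by blast
qed

lemma sum_axis_mult: "(\<Sum>a\<in>UNIV. axis i (1::real) $ a * f a) = f i"
  by (simp add: axis_def if_distrib[of "\<lambda>x. x * _"] cong: if_cong)

lemma sum_mult_axis: "(\<Sum>a\<in>UNIV. f a * axis i (1::real) $ a) = f i"
  by (simp add: axis_def if_distrib[of "\<lambda>x. _ * x"] cong: if_cong)

section \<open>Exact Einstein structures in a chart\<close>

text \<open>The content of the hypotheses in one coordinate domain, free of atlases.
  \<open>W\<close> is the component of R, and \<open>L\<close> encodes exactness: by
  \<open>trace_L\<close> the density \<open>exp L\<close> is parallel. \<open>Gh\<close> is known
  only through the conditions that characterize the Thomas connection.\<close>

locale exact_einstein_chart =
  fixes U :: "(real^2) set" and G :: "2 christoffel" and H :: "real^2 \<Rightarrow> real^2^2"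
    and W L :: "real^2 \<Rightarrow> real" and Gh :: "3 christoffel"
  assumes open_U: "open U"
    and smooth_G: "\<And>a b c. smooth_on U (\<lambda>u. G u $ a $ b $ c)"
    and sym_G: "\<And>u a b c. u \<in> U \<Longrightarrow> G u $ a $ b $ c = G u $ b $ a $ c"
    and smooth_H: "\<And>a b. smooth_on U (\<lambda>u. H u $ a $ b)"
    and sym_H: "\<And>u a b. u \<in> U \<Longrightarrow> H u $ a $ b = H u $ b $ a"
    and pos_H: "\<And>u v. u \<in> U \<Longrightarrow> v \<noteq> 0 \<Longrightarrow> v \<bullet> (H u *v v) > 0"
    and det_H: "\<And>u. u \<in> U \<Longrightarrow> det (H u) = 1"
    and smooth_W: "smooth_on U W"
    and neg_W: "\<And>u. u \<in> U \<Longrightarrow> W u < 0"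
    and smooth_L: "smooth_on U L"
    and trace_L: "\<And>u a. u \<in> U \<Longrightarrow> conn_trace G a u = pd a L u"
    and ricci_H: "\<And>u a b. u \<in> U \<Longrightarrow> ricci G a b u = W u / 2 * H u $ a $ b"
    and parallel_W: "\<And>u a. u \<in> U \<Longrightarrow> pd a W u = conn_trace G a u * W u"
    and codazzi: "\<And>u a b c. u \<in> U \<Longrightarrow> cov_tensor2 G (-1) H a b c u = cov_tensor2 G (-1) H b a c u"
    and sym_Gh: "\<And>p i j k. base_pt p \<in> U \<Longrightarrow> p $ 3 \<noteq> 0 \<Longrightarrow> Gh p $ i $ j $ k = Gh p $ j $ i $ k"
    and euler_Gh: "\<And>p v. base_pt p \<in> U \<Longrightarrow> p $ 3 \<noteq> 0 \<Longrightarrow> cov_deriv Gh (\<lambda>_. v) euler_field p = v"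
    and lift_Gh: "\<And>p X Y. base_pt p \<in> U \<Longrightarrow> p $ 3 \<noteq> 0 \<Longrightarrow> smooth_on U X \<Longrightarrow> smooth_on U Y \<Longrightarrow>
        cov_deriv Gh (hor_lift G X) (hor_lift G Y) p = hor_lift G (cov_deriv G X Y) p +
          (\<Sum>a\<in>UNIV. \<Sum>b\<in>UNIV. thomas_P G a b (base_pt p) *
              X (base_pt p) $ a * Y (base_pt p) $ b) *\<^sub>R euler_field p"
begin

abbreviation tau :: "2 \<Rightarrow> real^2 \<Rightarrow> real" where
  "tau \<equiv> conn_trace G"

definition Uhat :: "(real^3) set" where
  "Uhat = {p. base_pt p \<in> U \<and> p $ 3 \<noteq> 0}"

text \<open>The trace-free projective connection $\Pi$ and the coefficients with which it enters the Thomas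
  connection: $\hat\Gamma_{ab}{}^c = \Pi_{ab}{}^c$ and $\hat\Gamma_{ab}{}^3 = s\,Q_{ab}$.\<close>

definition Proj :: "2 \<Rightarrow> 2 \<Rightarrow> 2 \<Rightarrow> real^2 \<Rightarrow> real" where
  "Proj a b c u = G u $ a $ b $ c - ((if b = c then tau a u else 0) + (if a = c then tau b u else 0)) / 3"

definition Q :: "2 \<Rightarrow> 2 \<Rightarrow> real^2 \<Rightarrow> real" where
  "Q a b u = - (W u * H u $ a $ b) / 2 + ((\<Sum>c\<in>UNIV. tau c u * G u $ a $ b $ c) - pd a (tau b) u) / 3
    - tau a u * tau b u / 9"

lemma UhatD: "p \<in> Uhat \<Longrightarrow> base_pt p \<in> U" "p \<in> Uhat \<Longrightarrow> p $ 3 \<noteq> 0"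
  by (simp_all add: Uhat_def)

lemma open_Uhat: "open Uhat"
  unfolding Uhat_def by (rule open_hat_region[OF open_U])

lemma smooth_tau: "smooth_on U (tau a)"
  unfolding conn_trace_def[abs_def] by (intro smooth_on_sum open_U smooth_G)

lemma differentiable_G [simp]: "u \<in> U \<Longrightarrow> (\<lambda>u. G u $ a $ b $ c) differentiable (at u)"
  by (rule smooth_on_differentiable[OF smooth_G])

lemma differentiable_H [simp]: "u \<in> U \<Longrightarrow> (\<lambda>u. H u $ a $ b) differentiable (at u)"
  by (rule smooth_on_differentiable[OF smooth_H])

lemma differentiable_W [simp]: "u \<in> U \<Longrightarrow> W differentiable (at u)"
  by (rule smooth_on_differentiable[OF smooth_W])

lemma differentiable_tau [simp]: "u \<in> U \<Longrightarrow> tau a differentiable (at u)"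
  by (rule smooth_on_differentiable[OF smooth_tau])

lemma differentiable_pd_tau [simp]: "u \<in> U \<Longrightarrow> pd b (tau a) differentiable (at u)"
  by (rule smooth_on_differentiable[OF smooth_on_pd[OF smooth_tau]])

text \<open>\<open>L\<close> is a potential of the trace, so this is the symmetry of its second
  derivatives.\<close>

lemma tau_closed: "u \<in> U \<Longrightarrow> pd a (tau b) u = pd b (tau a) u"
  using pd_cong[OF open_U, of u "tau a" "pd a L" b] pd_cong[OF open_U, of u "tau b" "pd b L" a]
    trace_L pd_commute[OF open_U smooth_L, of u a b] by simp

lemma pd_pd_tau: "u \<in> U \<Longrightarrow> pd a (pd b (tau c)) u = pd b (pd a (tau c)) u"
  by (rule pd_commute[OF open_U smooth_tau])

lemma pd_G_sym: "u \<in> U \<Longrightarrow> pd m (\<lambda>u. G u $ a $ b $ c) u = pd m (\<lambda>u. G u $ b $ a $ c) u"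
  by (rule pd_cong[OF open_U _ sym_G])

lemma pd_H_sym: "u \<in> U \<Longrightarrow> pd m (\<lambda>u. H u $ a $ b) u = pd m (\<lambda>u. H u $ b $ a) u"
  by (rule pd_cong[OF open_U _ sym_H])

lemma Q_sym: "u \<in> U \<Longrightarrow> Q a b u = Q b a u"
  using sym_G[of u a b] sym_H[of u a b] tau_closed[of u a b] by (simp add: Q_def mult.commute)

lemma Proj_sym: "u \<in> U \<Longrightarrow> Proj a b c u = Proj b a c u"
  using sym_G[of u a b] by (simp add: Proj_def)

lemma thomas_P_eq: "u \<in> U \<Longrightarrow> thomas_P G a b u = - (W u * H u $ a $ b) / 2"
  using sym_H[of u a b]
  by (simp add: thomas_P_def ricci_sym_def ricci_skew_def ricci_H)

section \<open>Projective curvature and the Cotton tensor in coordinates\<close>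

lemma pd_Proj:
  assumes "u \<in> U"
  shows "pd m (Proj a b c) u = pd m (\<lambda>u. G u $ a $ b $ c) u
    - ((if b = c then pd m (tau a) u else 0) + (if a = c then pd m (tau b) u else 0)) / 3"
  using assms unfolding Proj_def[abs_def]
  by (cases "b = c"; cases "a = c") (simp_all add: pd_diff pd_add pd_divide_const pd_cmult)

lemma differentiable_Proj [simp]: "u \<in> U \<Longrightarrow> Proj a b c differentiable (at u)"
  unfolding Proj_def[abs_def] by (cases "b = c"; cases "a = c") simp_all

lemma differentiable_Q [simp]: "u \<in> U \<Longrightarrow> Q a b differentiable (at u)"
  unfolding Q_def[abs_def] by (simp add: sum_2)

lemma pd_Q:
  assumes "u \<in> U"
  shows "pd m (Q a b) u = - (pd m W u * H u $ a $ b + W u * pd m (\<lambda>u. H u $ a $ b) u) / 2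
    + ((\<Sum>c\<in>UNIV. pd m (tau c) u * G u $ a $ b $ c + tau c u * pd m (\<lambda>u. G u $ a $ b $ c) u)
        - pd m (pd a (tau b)) u) / 3
    - (pd m (tau a) u * tau b u + tau a u * pd m (tau b) u) / 9"
  using assms unfolding Q_def[abs_def] sum_2
  by (simp add: pd_diff pd_add pd_divide_const pd_mult pd_minus) (simp add: field_simps)

text \<open>Solved for a single derivative so that it can act as a rewrite rule in the coordinate
  checks below; \<open>pd_H_codazzi\<close> has the same purpose.\<close>

lemma curvature_G:
  "u \<in> U \<Longrightarrow> pd a (\<lambda>u. G u $ b $ c $ d) u = pd b (\<lambda>u. G u $ a $ c $ d) u
    - (\<Sum>q\<in>UNIV. G u $ a $ q $ d * G u $ b $ c $ q - G u $ b $ q $ d * G u $ a $ c $ q)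
    + (if a = d then W u / 2 * H u $ b $ c else 0) - (if b = d then W u / 2 * H u $ a $ c else 0)"
  using curvature_surface[of G a b c d u] ricci_H[of u b c] ricci_H[of u a c]
  by (auto simp: curvature_def split: if_splits)

text \<open>The left side is the curvature of \<open>Proj\<close>, and \<open>Q\<close> is minus its
  Ricci form; on a surface this is all there is. By skewness in \<open>a\<close> and
  \<open>b\<close> only the pair \<open>1\<close>, \<open>2\<close> carries content.\<close>

lemma curvature_Proj:
  assumes u: "u \<in> U"
  shows "pd a (Proj b c d) u - pd b (Proj a c d) u
      + (\<Sum>q\<in>UNIV. Proj a q d u * Proj b c q u - Proj b q d u * Proj a c q u)
    = (if b = d then Q a c u else 0) - (if a = d then Q b c u else 0)"
proof -
  have *: "\<forall>c d. pd 1 (Proj 2 c d) u - pd 2 (Proj 1 c d) u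
      + (\<Sum>q\<in>UNIV. Proj 1 q d u * Proj 2 c q u - Proj 2 q d u * Proj 1 c q u)
    = (if 2 = d then Q 1 c u else 0) - (if 1 = d then Q 2 c u else 0)"
    using u sym_G[OF u, of 2 1] tau_closed[OF u, of 2 1] sym_H[OF u, of 2 1] pd_G_sym[OF u, of _ 2 1]
    by (simp add: forall_2 pd_Proj curvature_G[OF u, of 1 2] Proj_def Q_def sum_2, simp add: field_simps)
  have "\<forall>a b. pd a (Proj b c d) u - pd b (Proj a c d) u
      + (\<Sum>q\<in>UNIV. Proj a q d u * Proj b c q u - Proj b q d u * Proj a c q u)
    = (if b = d then Q a c u else 0) - (if a = d then Q b c u else 0)"
    using *[rule_format, of c d] by (simp add: forall_2 sum_2)
  then show ?thesis by blast
qed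

lemma pd_H_codazzi:
  assumes "u \<in> U"
  shows "pd a (\<lambda>u. H u $ b $ c) u = pd b (\<lambda>u. H u $ a $ c) u
    + (\<Sum>p\<in>UNIV. G u $ a $ c $ p * H u $ b $ p) - (\<Sum>p\<in>UNIV. G u $ b $ c $ p * H u $ a $ p)
    - tau a u * H u $ b $ c + tau b u * H u $ a $ c"
  using codazzi[OF assms, of a b c] by (simp add: cov_tensor2_def sym_G[OF assms, of a b])

text \<open>The skew covariant derivative of \<open>Q\<close> along \<open>Proj\<close>, which is
  the form in which the Cotton tensor enters the fibre component of the Thomas curvature. The
  derivatives of \<open>W\<close> and \<open>H\<close> are handled by \<open>parallel_W\<close> and
  \<open>pd_H_codazzi\<close>, the second derivatives of the trace by
  \<open>pd_pd_tau\<close>.\<close>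

lemma cotton_Q:
  assumes u: "u \<in> U"
  shows "pd a (Q b c) u - pd b (Q a c) u + (\<Sum>q\<in>UNIV. Q a q u * Proj b c q u - Q b q u * Proj a c q u) = 0"
proof -
  have *: "\<forall>c. pd 1 (Q 2 c) u - pd 2 (Q 1 c) u
      + (\<Sum>q\<in>UNIV. Q 1 q u * Proj 2 c q u - Q 2 q u * Proj 1 c q u) = 0"
    using u sym_G[OF u, of 2 1] tau_closed[OF u, of 2 1] sym_H[OF u, of 2 1] pd_G_sym[OF u, of _ 2 1]
      pd_pd_tau[OF u, of 2 1] pd_H_sym[OF u, of _ 2 1]
    by (simp add: forall_2 pd_Q curvature_G[OF u, of 1 2] pd_H_codazzi[OF u, of 1 2]
        Proj_def Q_def sum_2 parallel_W, simp add: field_simps)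
  have "\<forall>a b. pd a (Q b c) u - pd b (Q a c) u
      + (\<Sum>q\<in>UNIV. Q a q u * Proj b c q u - Q b q u * Proj a c q u) = 0"
    using *[rule_format, of c] by (simp add: forall_2 sum_2)
  then show ?thesis by blast
qed

section \<open>Christoffel symbols of the Thomas connection\<close>

lemma Gh_euler:
  assumes "p \<in> Uhat"
  shows "Gh p $ i $ 3 $ k = (if i = k \<and> k \<noteq> 3 then 1 / p $ 3 else 0)"
proof -
  have pd: "pd i (\<lambda>w. euler_field w $ k) p = (if i = 3 \<and> k = 3 then 1 else 0)"
    by (cases k rule: hidx_cases) (simp_all add: euler_field_nth pd_fibre pd_const)
  have "cov_deriv Gh (\<lambda>_. axis i 1) euler_field p $ k = axis i 1 $ k"
    using euler_Gh UhatD[OF assms] by simp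
  \<comment> \<open>The Euler field has the single component \<open>p $ 3\<close> in direction
    \<open>3\<close>. For \<open>i = k = 3\<close> its derivative alone gives the identity, so that
    symbol vanishes; for \<open>i = k\<close> in the base the symbol must supply it, whence
    \<open>1 / p $ 3\<close>.\<close>
  then have "pd i (\<lambda>w. euler_field w $ k) p + Gh p $ i $ 3 $ k * p $ 3 = (if i = k then 1 else 0)"
    by (simp add: cov_deriv_def sum_axis_mult sum_hidx euler_field_nth)
      (simp add: axis_def)
  then show ?thesis using UhatD(2)[OF assms] by (auto simp: pd field_simps split: if_splits)
qed

text \<open>The lift condition for the constant fields \<open>axis a 1\<close> and
  \<open>axis b 1\<close> is solved for the one unknown symbol. Their lifts have fibre components
  \<open>p $ 3 * tau / 3\<close>: with \<open>Gh_euler\<close> these give the trace corrections in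
  \<open>Proj\<close>, and their derivatives and the lift of the covariant derivative give the trace
  terms in \<open>Q\<close>.\<close>

lemma Gh_base:
  assumes "p \<in> Uhat"
  shows "Gh p $ hidx a $ hidx b $ hidx c = Proj a b c (base_pt p)"
    and "Gh p $ hidx a $ hidx b $ 3 = p $ 3 * Q a b (base_pt p)"
proof -
  note u = UhatD[OF assms]
  let ?u = "base_pt p" and ?s = "p $ 3"
  let ?X = "\<lambda>_::real^2. axis a 1 :: real^2" and ?Y = "\<lambda>_::real^2. axis b 1 :: real^2"
  have h: "hor_lift G (\<lambda>_. axis c 1) q $ 3 = q $ 3 * tau c (base_pt q) / 3" for c q
    by (simp add: hor_lift_nth sum_mult_axis)
  have d: "(\<lambda>q. tau b (base_pt q)) differentiable (at p)"
    by (intro differentiable_base_pt differentiable_tau u)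
  have pd1: "pd i (\<lambda>w. hor_lift G ?Y w $ hidx c) p = 0" for i c
    by (simp add: hor_lift_nth pd_const)
  have pd2: "pd (hidx a) (\<lambda>w. hor_lift G ?Y w $ 3) p = ?s * pd a (tau b) ?u / 3"
    "pd 3 (\<lambda>w. hor_lift G ?Y w $ 3) p = tau b ?u / 3"
    using u d by (simp_all add: h pd_divide_const pd_mult pd_fibre pd_base_pt differentiable_fibre)
  have cov: "cov_deriv G ?X ?Y ?u $ c = G ?u $ a $ b $ c" for c
    by (simp add: cov_deriv_def sum_axis_mult sum_mult_axis pd_const)
  have lift3: "hor_lift G (cov_deriv G ?X ?Y) p $ 3 = ?s / 3 * (\<Sum>c\<in>UNIV. tau c ?u * G ?u $ a $ b $ c)"
    by (simp add: hor_lift_nth cov)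
  have sumP: "(\<Sum>c\<in>UNIV. \<Sum>d\<in>UNIV. thomas_P G c d ?u * ?X ?u $ c * ?Y ?u $ d) = thomas_P G a b ?u"
    using exhaust_2[of a] exhaust_2[of b] by (auto simp: sum_2 axis_def)
  have *: "cov_deriv Gh (hor_lift G ?X) (hor_lift G ?Y) p $ k =
      hor_lift G (cov_deriv G ?X ?Y) p $ k + thomas_P G a b ?u * euler_field p $ k" for k
    using lift_Gh[OF u, of ?X ?Y] sumP by (simp add: smooth_on_const)
  have lhs: "cov_deriv Gh (hor_lift G ?X) (hor_lift G ?Y) p $ k =
      pd (hidx a) (\<lambda>w. hor_lift G ?Y w $ k) p + Gh p $ hidx a $ hidx b $ k
        + Gh p $ hidx a $ 3 $ k * (?s * tau b ?u / 3)
      + ?s * tau a ?u / 3 * (pd 3 (\<lambda>w. hor_lift G ?Y w $ k) p + Gh p $ 3 $ hidx b $ k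
        + Gh p $ 3 $ 3 $ k * (?s * tau b ?u / 3))" for k
    unfolding cov_deriv_def sum_hidx vec_lambda_beta h hor_lift_nth(1) sum_axis_mult sum_mult_axis
    by simp
  have sym: "Gh p $ 3 $ i $ k = Gh p $ i $ 3 $ k" for i k
    using sym_Gh u by blast
  show "Gh p $ hidx a $ hidx b $ hidx c = Proj a b c ?u"
    using *[of "hidx c"] u(2)
    by (simp add: lhs pd1 sym Gh_euler[OF assms] hor_lift_nth(1) cov euler_field_nth Proj_def pd_const field_simps
        split: if_splits)
  show "Gh p $ hidx a $ hidx b $ 3 = ?s * Q a b ?u"
    using *[of 3] u(2)
    by (simp add: lhs pd2 sym Gh_euler[OF assms] lift3 euler_field_nth Q_def
        thomas_P_eq[OF u(1)] field_simps)
qed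

section \<open>Flatness of the Thomas connection\<close>

lemma Gh_sym: "p \<in> Uhat \<Longrightarrow> Gh p $ 3 $ i $ k = Gh p $ i $ 3 $ k"
  using sym_Gh UhatD by blast

lemma pd_Gh:
  assumes p: "p \<in> Uhat"
  shows "pd (hidx m) (\<lambda>w. Gh w $ hidx a $ hidx b $ hidx c) p = pd m (Proj a b c) (base_pt p)"
    and "pd 3 (\<lambda>w. Gh w $ hidx a $ hidx b $ hidx c) p = 0"
    and "pd (hidx m) (\<lambda>w. Gh w $ hidx a $ hidx b $ 3) p = p $ 3 * pd m (Q a b) (base_pt p)"
    and "pd 3 (\<lambda>w. Gh w $ hidx a $ hidx b $ 3) p = Q a b (base_pt p)"
    and "pd n (\<lambda>w. Gh w $ i $ 3 $ k) p = (if n = 3 \<and> i = k \<and> k \<noteq> 3 then - 1 / (p $ 3)\<^sup>2 else 0)"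
    and "pd n (\<lambda>w. Gh w $ 3 $ i $ k) p = (if n = 3 \<and> i = k \<and> k \<noteq> 3 then - 1 / (p $ 3)\<^sup>2 else 0)"
proof -
  note u = UhatD[OF p]
  show "pd (hidx m) (\<lambda>w. Gh w $ hidx a $ hidx b $ hidx c) p = pd m (Proj a b c) (base_pt p)"
    "pd 3 (\<lambda>w. Gh w $ hidx a $ hidx b $ hidx c) p = 0"
    using u by (simp_all add: pd_cong[OF open_Uhat p, of "\<lambda>w. Gh w $ hidx a $ hidx b $ hidx c"
          "\<lambda>w. Proj a b c (base_pt w)"] Gh_base pd_base_pt)
  have "(\<lambda>w. Q a b (base_pt w)) differentiable (at p)"
    by (intro differentiable_base_pt differentiable_Q u)
  then show "pd (hidx m) (\<lambda>w. Gh w $ hidx a $ hidx b $ 3) p = p $ 3 * pd m (Q a b) (base_pt p)"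
    "pd 3 (\<lambda>w. Gh w $ hidx a $ hidx b $ 3) p = Q a b (base_pt p)"
    using u by (simp_all add: pd_cong[OF open_Uhat p, of "\<lambda>w. Gh w $ hidx a $ hidx b $ 3"
          "\<lambda>w. w $ 3 * Q a b (base_pt w)"] Gh_base pd_mult differentiable_fibre pd_base_pt pd_fibre)
  show *: "pd n (\<lambda>w. Gh w $ i $ 3 $ k) p = (if n = 3 \<and> i = k \<and> k \<noteq> 3 then - 1 / (p $ 3)\<^sup>2 else 0)"
    using u pd_cong[OF open_Uhat p, of "\<lambda>w. Gh w $ i $ 3 $ k"
        "\<lambda>w. if i = k \<and> k \<noteq> 3 then 1 / w $ 3 else 0"] Gh_euler
    by (cases "i = k \<and> k \<noteq> 3") (auto simp: pd_inverse_fibre pd_const)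
  show "pd n (\<lambda>w. Gh w $ 3 $ i $ k) p = (if n = 3 \<and> i = k \<and> k \<noteq> 3 then - 1 / (p $ 3)\<^sup>2 else 0)"
    using * pd_cong[OF open_Uhat p, of "\<lambda>w. Gh w $ 3 $ i $ k" "\<lambda>w. Gh w $ i $ 3 $ k"]
      Gh_sym by simp
qed

text \<open>With all indices in the base, the intermediate index \<open>3\<close> contributes
  \<open>Q\<close> times a Kronecker delta, exactly opposite to \<open>curvature_Proj\<close>. With
  upper index \<open>3\<close> and base indices below, the curvature is \<open>p $ 3\<close> times
  \<open>cotton_Q\<close>. If a lower index is \<open>3\<close>, the explicit dependence on
  \<open>p $ 3\<close> and the symmetry of \<open>Proj\<close> and \<open>Q\<close> suffice.\<close>

lemma curvature_Gh:
  assumes p: "p \<in> Uhat"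
  shows "curvature Gh i j l k p = 0"
proof -
  note u = UhatD[OF p]
  note sym = Gh_sym[OF p]
  note Gh = Gh_base[OF p] Gh_euler[OF p]
  have base: "curvature Gh (hidx a) (hidx b) (hidx c) (hidx d) p = 0" for a b c d
    using curvature_Proj[OF u(1), of a b c d] u(2)
    by (auto simp: curvature_def pd_Gh[OF p] sum_hidx sym Gh sum_subtractf split: if_splits)
  have fibre: "curvature Gh (hidx a) (hidx b) (hidx c) 3 p = 0" for a b c
  proof -
    have "curvature Gh (hidx a) (hidx b) (hidx c) 3 p = p $ 3 * (pd a (Q b c) (base_pt p) - pd b (Q a c) (base_pt p)
      + (\<Sum>q\<in>UNIV. Q a q (base_pt p) * Proj b c q (base_pt p) - Q b q (base_pt p) * Proj a c q (base_pt p)))"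
      by (simp add: curvature_def pd_Gh[OF p] sum_hidx sym Gh algebra_simps sum_distrib_left)
    then show ?thesis using cotton_Q[OF u(1)] by simp
  qed
  have skew: "curvature Gh i j l k p = - curvature Gh j i l k p" for i j l k
    by (simp add: curvature_def sum_subtractf)
  have third: "\<forall>i j k. curvature Gh i j 3 k p = 0"
    using u(2) Q_sym[OF u(1), of 2 1] Proj_sym[OF u(1), of 2 1]
    by (simp add: all_hidx forall_2 curvature_def pd_Gh[OF p] sum_hidx sum_2 sym Gh power2_eq_square
        del: hidx_simps)
  have mixed: "\<forall>a c k. curvature Gh (hidx a) 3 (hidx c) k p = 0"
    using u(2)
    by (simp add: all_hidx forall_2 curvature_def pd_Gh[OF p] sum_hidx sum_2 sym Gh power2_eq_square
        del: hidx_simps)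
  have "curvature Gh 3 3 l k p = 0" by (simp add: curvature_def)
  then show ?thesis
    using base fibre third mixed skew[of 3 "hidx _"]
    by (cases i rule: hidx_cases; cases j rule: hidx_cases; cases l rule: hidx_cases; cases k rule: hidx_cases)
      simp_all
qed

end

section \<open>The potential\<close>

text \<open>\<open>Psi C t\<close> with the lower limit \<open>exp (- t / 3)\<close> as the
  variable, so that the potential becomes a function of rho.\<close>

definition profile :: "real \<Rightarrow> real \<Rightarrow> real" where
  "profile C x = integral {x .. C powr (1/3)} (\<lambda>r. (C - r^3) powr (1/3))"

lemma cube_root_cube: "C > 0 \<Longrightarrow> (C powr (1/3)) ^ 3 = (C::real)"
  by (simp add: powr_power)

lemma cube_less:
  assumes "C > 0" "0 \<le> x" "x < C powr (1/3)"
  shows "x ^ 3 < (C::real)"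
  using power_strict_mono[OF assms(3,2), of 3] cube_root_cube[OF assms(1)] by simp

text \<open>The moving endpoint is the lower one, hence the sign; writing the integral as a
  difference of integrals from \<open>0\<close> brings the fundamental theorem into play. The
  integrand is continuous up to the endpoint \<open>C powr (1/3)\<close>, where the base of the
  power vanishes.\<close>

lemma profile_has_derivative:
  assumes C: "C > 0" and x: "0 < x" "x < C powr (1/3)"
  shows "(profile C has_real_derivative - ((C - x^3) powr (1/3))) (at x)"
proof -
  let ?c = "C powr (1/3)" and ?f = "\<lambda>r::real. (C - r^3) powr (1/3)"
  have "r ^ 3 \<le> C" if "0 \<le> r" "r \<le> ?c" for r
    using power_mono[OF that(2,1), of 3] cube_root_cube[OF C] by simp
  then have cont: "continuous_on {0..?c} ?f"
    by (intro continuous_on_powr' continuous_intros) auto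
  have "((\<lambda>y. integral {0..y} ?f) has_real_derivative ?f x) (at x within {0..?c})"
    by (rule integral_has_real_derivative[OF cont]) (use x in auto)
  then have "((\<lambda>y. integral {0..y} ?f) has_real_derivative ?f x) (at x)"
    using x by (simp add: at_within_Icc_at)
  then have d: "((\<lambda>y. integral {0..?c} ?f - integral {0..y} ?f) has_real_derivative - ?f x) (at x)"
    by (auto intro!: derivative_eq_intros)
  have "integral {0..?c} ?f - integral {0..y} ?f = profile C y" if "y \<in> {0<..<?c}" for y
    using Henstock_Kurzweil_Integration.integral_combine[of 0 y ?c ?f]
      integrable_continuous_real[OF cont] that by (simp add: profile_def)
  from has_field_derivative_transform_within_open[OF d _ _ this, of "{0<..<?c}"] x
  show ?thesis by simp
qed

section \<open>The radial function rho and its Hessian\<close>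

context exact_einstein_chart
begin

text \<open>The coordinate expression of rho. The absolute value of \<open>p $ 3\<close> is written
  as a power of its square, which is visibly smooth on both sides of the zero section.\<close>

definition rad :: "real^3 \<Rightarrow> real" where
  "rad p = (p $ 3 * p $ 3) powr (1/2) * (- W (base_pt p) / 2) powr (- 1/3)"

lemma rad_pos: "p \<in> Uhat \<Longrightarrow> rad p > 0"
  using UhatD neg_W by (fastforce simp: rad_def)

text \<open>Eliminates \<open>W\<close> from the determinant of the Hessian and leaves a function of
  the fibre coordinate alone.\<close>

lemma rad_cube:
  assumes "p \<in> Uhat"
  shows "- W (base_pt p) / 2 * rad p ^ 3 = \<bar>p $ 3\<bar> ^ 3"
proof -
  have w: "- W (base_pt p) / 2 > 0" using neg_W UhatD[OF assms] by simp
  have "((- W (base_pt p) / 2) powr (- 1/3)) ^ 3 = 1 / (- W (base_pt p) / 2)"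
    using w by (subst powr_power) (auto simp: powr_neg_one)
  moreover have "(p $ 3 * p $ 3) powr (1/2) = \<bar>p $ 3\<bar>"
    by (simp add: powr_half_sqrt)
  ultimately show ?thesis using w by (simp add: rad_def power_mult_distrib)
qed

lemma smooth_on_base_pt: "smooth_on U f \<Longrightarrow> smooth_on Uhat (\<lambda>p. f (base_pt p))"
  unfolding Uhat_def by (rule smooth_on_compose_base_pt[OF open_U])

lemma smooth_on_fibre: "smooth_on Uhat (\<lambda>p. p $ 3)"
  by (intro smooth_on_component smooth_on_ident open_Uhat)

lemma smooth_rad: "smooth_on Uhat rad"
  unfolding rad_def[abs_def]
proof (intro smooth_on_mult smooth_on_powr smooth_on_divide_const smooth_on_minus smooth_on_fibre
    smooth_on_base_pt smooth_W open_Uhat)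
  fix p assume p: "p \<in> Uhat"
  show "0 < p $ 3 * p $ 3" using UhatD(2)[OF p] by (simp add: zero_less_mult_iff) linarith
  show "0 < - W (base_pt p) / 2" using neg_W UhatD[OF p] by simp
qed

lemma differentiable_rad: "p \<in> Uhat \<Longrightarrow> rad differentiable (at p)"
  by (rule smooth_on_differentiable[OF smooth_rad])

lemma beta_form_nth:
  "beta_form G p $ hidx a = - tau a (base_pt p) / 3" "beta_form G p $ 3 = 1 / p $ 3"
  using exhaust_2[of a] by (auto simp: beta_form_def)

text \<open>Logarithmic differentiation: as \<open>W\<close> is parallel, its logarithmic derivative
  is the trace, and the exponent \<open>- 1/3\<close> makes this the base part of
  \<open>beta_form\<close>; the fibre factor supplies \<open>1 / p $ 3\<close>.\<close>

lemma pd_rad: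
  assumes p: "p \<in> Uhat"
  shows "pd i rad p = rad p * beta_form G p $ i"
proof -
  note u = UhatD[OF p]
  have s: "p $ 3 * p $ 3 > 0" using u by (simp add: zero_less_mult_iff) linarith
  have w: "- W (base_pt p) / 2 > 0" using neg_W u by simp
  have dW: "(\<lambda>p. - W (base_pt p) / 2) differentiable (at p)"
    using differentiable_base_pt[OF differentiable_W[OF u(1)]] by simp
  have ds: "(\<lambda>p. p $ 3 * p $ 3) differentiable (at p)"
    by (intro differentiable_mult differentiable_fibre)
  have "pd i rad p = rad p * (pd i (\<lambda>p. p $ 3 * p $ 3) p / (p $ 3 * p $ 3) / 2
      - pd i (\<lambda>p. - W (base_pt p) / 2) p / (- W (base_pt p) / 2) / 3)"
    unfolding rad_def[abs_def]
    by (subst pd_mult[OF differentiable_powr_const[OF ds s] differentiable_powr_const[OF dW w]],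
        subst pd_powr[OF ds s], subst pd_powr[OF dW w]) (simp add: algebra_simps)
  also have "pd i (\<lambda>p. p $ 3 * p $ 3) p / (p $ 3 * p $ 3) / 2 = (if i = 3 then 1 / p $ 3 else 0)"
    using u(2) by (simp add: pd_mult differentiable_fibre pd_fibre)
  also have "pd i (\<lambda>p. - W (base_pt p) / 2) p / (- W (base_pt p) / 2) / 3 =
      (if i = 3 then 0 else - beta_form G p $ i)"
    using u(1) neg_W[OF u(1)] differentiable_base_pt[OF differentiable_W[OF u(1)]]
    by (cases i rule: hidx_cases)
      (simp_all add: pd_divide_const pd_minus pd_base_pt parallel_W beta_form_nth)
  finally show ?thesis by (simp add: beta_form_nth)
qed

lemma differentiable_beta:
  assumes p: "p \<in> Uhat"
  shows "(\<lambda>p. beta_form G p $ i) differentiable (at p)"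
  using differentiable_base_pt[OF differentiable_tau] differentiable_inverse_fibre UhatD[OF p]
  by (cases i rule: hidx_cases) (simp_all add: beta_form_nth)

lemma pd_beta:
  assumes p: "p \<in> Uhat"
  shows "pd (hidx a) (\<lambda>p. beta_form G p $ hidx b) p = - pd a (tau b) (base_pt p) / 3"
    and "pd 3 (\<lambda>p. beta_form G p $ hidx b) p = 0"
    and "pd i (\<lambda>p. beta_form G p $ 3) p = (if i = 3 then - 1 / (p $ 3)\<^sup>2 else 0)"
  using differentiable_base_pt[OF differentiable_tau] UhatD[OF p]
  by (simp_all add: beta_form_nth pd_divide_const pd_minus pd_base_pt pd_inverse_fibre)

text \<open>Each of the two trace corrections in \<open>Proj\<close> contributes
  \<open>tau a u * tau b u / 9\<close>.\<close>

lemma Proj_beta: "(\<Sum>c\<in>UNIV. Proj a b c u * (- tau c u / 3)) =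
    2 / 9 * (tau a u * tau b u) - (\<Sum>c\<in>UNIV. tau c u * G u $ a $ b $ c) / 3"
  using exhaust_2[of a] exhaust_2[of b] by (auto simp: sum_2 Proj_def field_simps)

text \<open>Here $M$ is $\varrho^{-1}\hat\nabla d\varrho$ for $\varrho$ = \<open>rad\<close>, since $d\varrho = \varrho\beta$.\<close>

lemma hess_rad:
  assumes p: "p \<in> Uhat"
  defines "M \<equiv> \<lambda>i j. beta_form G p $ i * beta_form G p $ j + pd i (\<lambda>p. beta_form G p $ j) p
    - (\<Sum>k\<in>UNIV. Gh p $ i $ j $ k * beta_form G p $ k)"
  shows "M (hidx a) (hidx b) = W (base_pt p) / 2 * H (base_pt p) $ a $ b"
    and "M i 3 = 0" and "M 3 i = 0"
proof -
  note u = UhatD[OF p]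
  \<comment> \<open>The products of traces occur with coefficients 1/9 from beta beta, -2/9 from
    \<open>Proj_beta\<close> and 1/9 from \<open>Q\<close>, and cancel, as do the derivatives of the
    trace.\<close>
  show "M (hidx a) (hidx b) = W (base_pt p) / 2 * H (base_pt p) $ a $ b"
    using u
    unfolding M_def pd_beta[OF p] sum_hidx Gh_base[OF p] unfolding beta_form_nth Proj_beta Q_def
    by (simp add: field_simps)
  \<comment> \<open>Invariantly: rho is homogeneous of degree one and the derivative of the Euler
    field is the identity, so the Hessian of rho annihilates the Euler field.\<close>
  show i3: "M i 3 = 0" for i
  proof (cases i rule: hidx_cases)
    case (1 a)
    show ?thesis
      using u(2) exhaust_2[of a] unfolding 1 M_def pd_beta[OF p] sum_hidx Gh_euler[OF p]
      unfolding beta_form_nth by (auto simp: sum_2 mult.commute)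
  next
    case 2
    show ?thesis
      using u(2) unfolding 2 M_def pd_beta[OF p] sum_hidx Gh_euler[OF p]
      unfolding beta_form_nth by (simp add: power2_eq_square)
  qed
  show "M 3 i = 0"
  proof (cases i rule: hidx_cases)
    case (1 a)
    show ?thesis
      using i3[of "hidx a"] unfolding 1 M_def pd_beta[OF p] Gh_sym[OF p, of "hidx a"]
      by (simp add: mult.commute)
  qed (use i3 in simp)
qed

text \<open>Turns out to be the chart image of \<open>Mhat_sub\<close>; it is the region where
  \<open>C - rad p ^ 3\<close> is positive.\<close>

definition sub :: "real \<Rightarrow> (real^3) set" where
  "sub C = {p \<in> Uhat. rad p < C powr (1/3)}"

lemma subD: "p \<in> sub C \<Longrightarrow> p \<in> Uhat" "p \<in> sub C \<Longrightarrow> rad p < C powr (1/3)"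
  by (simp_all add: sub_def)

lemma sub_subset: "sub C \<subseteq> Uhat"
  by (auto simp: sub_def)

lemma open_sub: "open (sub C)"
proof -
  have "open (Uhat \<inter> rad -` {..<C powr (1/3)})"
    using continuous_on_open_vimage[OF open_Uhat] smooth_on_continuous[OF smooth_rad]
    by (metis inf_commute open_lessThan)
  then show ?thesis by (simp add: sub_def vimage_def Int_def)
qed

section \<open>The Hessian of the potential\<close>

context
  fixes C :: real
  assumes C_pos: "C > 0"
begin

abbreviation phi :: "real^3 \<Rightarrow> real" where
  "phi \<equiv> \<lambda>p. profile C (rad p)"

abbreviation cfun :: "real^3 \<Rightarrow> real" where
  "cfun \<equiv> \<lambda>p. (C - rad p ^ 3) powr (1/3)"

lemma sub_pos: "p \<in> sub C \<Longrightarrow> C - rad p ^ 3 > 0"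
  using cube_less[OF C_pos] rad_pos subD by (metis diff_gt_0_iff_gt less_imp_le)

lemma phi_has_derivative:
  assumes "p \<in> sub C"
  shows "(phi has_derivative (\<lambda>v. - cfun p * frechet_derivative rad (at p) v)) (at p)"
  using has_derivative_compose[OF differentiable_has_derivative[OF differentiable_rad]
      profile_has_derivative[OF C_pos rad_pos, unfolded has_field_derivative_def]] subD[OF assms]
  by blast

lemma smooth_cfun: "smooth_on (sub C) cfun"
  using smooth_on_subset[OF smooth_rad] subD(1) sub_pos
  by (intro smooth_on_powr smooth_on_diff smooth_on_power smooth_on_const open_sub) auto

lemma smooth_phi: "smooth_on (sub C) phi"
proof (rule smooth_on_antiderivative[OF open_sub phi_has_derivative])
  fix b :: "real^3" assume "b \<in> Basis"
  then obtain i where "b = axis i 1" by (auto simp: Basis_vec_def)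
  then have "(\<lambda>p. frechet_derivative rad (at p) b) = pd i rad" by (auto simp: pd_def)
  then show "smooth_on (sub C) (\<lambda>p. - cfun p * frechet_derivative rad (at p) b)"
    using smooth_on_subset[OF smooth_on_pd[OF smooth_rad] sub_subset]
    by (auto intro!: smooth_on_mult smooth_on_minus smooth_cfun open_sub)
qed

lemma pd_phi:
  assumes "p \<in> sub C"
  shows "pd i phi p = - cfun p * (rad p * beta_form G p $ i)"
  using pd_eq[OF phi_has_derivative[OF assms]] pd_rad[OF subD(1)[OF assms]] by (simp add: pd_def)

text \<open>Arranged so that the last bracket, completed by the connection term of the Hessian, is
  the expression \<open>M\<close> of \<open>hess_rad\<close>.\<close>

lemma pd_pd_phi:
  assumes p: "p \<in> sub C"
  shows "pd i (pd j phi) p = cfun p * (rad p ^ 4 / (C - rad p ^ 3) * beta_form G p $ i * beta_form G p $ j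
    - rad p * (beta_form G p $ i * beta_form G p $ j + pd i (\<lambda>p. beta_form G p $ j) p))"
proof -
  note pb = subD(1)[OF p]
  have dr: "rad differentiable (at p)" by (rule differentiable_rad[OF pb])
  have d3: "(\<lambda>p. C - rad p ^ 3) differentiable (at p)"
    using dr by (intro differentiable_diff differentiable_const differentiable_power)
  have p3: "pd i (\<lambda>p. C - rad p ^ 3) p = - 3 * rad p ^ 3 * beta_form G p $ i"
    unfolding power3_eq_cube using dr pd_rad[OF pb]
    by (simp add: pd_diff pd_const pd_mult algebra_simps)
  have dc: "cfun differentiable (at p)" by (rule smooth_on_differentiable[OF smooth_cfun p])
  have db: "(\<lambda>p. rad p * beta_form G p $ j) differentiable (at p)"
    by (intro differentiable_mult dr differentiable_beta pb)
  have "pd i (pd j phi) p = pd i (\<lambda>p. - cfun p * (rad p * beta_form G p $ j)) p"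
    by (rule pd_cong[OF open_sub p pd_phi])
  also have "\<dots> = - pd i cfun p * (rad p * beta_form G p $ j)
      - cfun p * (pd i rad p * beta_form G p $ j + rad p * pd i (\<lambda>p. beta_form G p $ j) p)"
    using dc db differentiable_beta[OF pb] dr by (simp add: pd_mult pd_minus)
  also have "pd i cfun p = - cfun p * rad p ^ 3 * beta_form G p $ i / (C - rad p ^ 3)"
    by (simp add: pd_powr[OF d3 sub_pos[OF p]] p3)
  finally show ?thesis
    by (simp add: pd_rad[OF pb] algebra_simps power3_eq_cube power4_eq_xxxx)
qed

text \<open>The coefficient \<open>A\<close> equals \<open>rad p ^ 4 / cfun p ^ 2\<close>, because
  \<open>C - rad p ^ 3\<close> is the cube of \<open>cfun p\<close>; the uncancelled form is the one
  that differentiating the power delivers.\<close>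

lemma hess_phi:
  assumes p: "p \<in> sub C"
  defines "A \<equiv> cfun p * rad p ^ 4 / (C - rad p ^ 3)"
    and "B \<equiv> cfun p * rad p * (- W (base_pt p) / 2)"
  shows "hess Gh phi p $ hidx a $ hidx b =
      A * beta_form G p $ hidx a * beta_form G p $ hidx b + B * H (base_pt p) $ a $ b"
    and "hess Gh phi p $ i $ 3 = A * beta_form G p $ i * beta_form G p $ 3"
    and "hess Gh phi p $ 3 $ i = A * beta_form G p $ 3 * beta_form G p $ i"
proof -
  have *: "hess Gh phi p $ i $ j = A * beta_form G p $ i * beta_form G p $ j - cfun p * rad p *
    (beta_form G p $ i * beta_form G p $ j + pd i (\<lambda>p. beta_form G p $ j) p
    - (\<Sum>k\<in>UNIV. Gh p $ i $ j $ k * beta_form G p $ k))" for i j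
    by (simp add: hess_def pd_pd_phi[OF p] pd_phi[OF p] A_def sum_distrib_left sum_negf algebra_simps)
  show "hess Gh phi p $ hidx a $ hidx b =
      A * beta_form G p $ hidx a * beta_form G p $ hidx b + B * H (base_pt p) $ a $ b"
    "hess Gh phi p $ i $ 3 = A * beta_form G p $ i * beta_form G p $ 3"
    "hess Gh phi p $ 3 $ i = A * beta_form G p $ 3 * beta_form G p $ i"
    unfolding * hess_rad[OF subD(1)[OF p]] by (simp_all add: B_def)
qed

lemma hess_phi_coefficients:
  assumes p: "p \<in> sub C"
  shows "cfun p * rad p ^ 4 / (C - rad p ^ 3) > 0" "cfun p * rad p * (- W (base_pt p) / 2) > 0"
  using sub_pos[OF p] rad_pos[OF subD(1)[OF p]] neg_W[OF UhatD(1)[OF subD(1)[OF p]]]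
  by (simp_all add: mult_pos_neg)

text \<open>The beta part has rank one, so row operations remove the horizontal components of beta.
  The defining equation of the profile makes \<open>cfun\<close> drop out of the remaining
  product.\<close>

lemma det_hess_phi:
  assumes p: "p \<in> sub C"
  shows "det (hess Gh phi p) = (p $ 3) ^ 4"
proof -
  note pb = subD(1)[OF p]
  note u = UhatD[OF pb]
  let ?q = "cfun p" and ?r = "rad p" and ?f = "C - rad p ^ 3" and ?w = "- W (base_pt p) / 2"
  let ?A = "?q * ?r ^ 4 / ?f" and ?B = "?q * ?r * ?w"
  have H: "H (base_pt p) $ 1 $ 1 * H (base_pt p) $ 2 $ 2 - H (base_pt p) $ 1 $ 2 * H (base_pt p) $ 1 $ 2 = 1"
    using det_H[OF u(1)] sym_H[OF u(1), of 2 1] by (simp add: det_2)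
  \<comment> \<open>Here \<open>x\<close>, \<open>y\<close>, \<open>z\<close> are the components of
    beta; of these only the fibre component \<open>z\<close> survives.\<close>
  have det: "(A * x * x + B * h11) * (A * y * y + B * h22) * (A * z * z)
      + (A * x * y + B * h12) * (A * y * z) * (A * z * x)
      + (A * x * z) * (A * y * x + B * h12) * (A * z * y)
      - (A * x * x + B * h11) * (A * y * z) * (A * z * y)
      - (A * x * y + B * h12) * (A * y * x + B * h12) * (A * z * z)
      - (A * x * z) * (A * y * y + B * h22) * (A * z * x)
    = A * B^2 * z^2 * (h11 * h22 - h12 * h12)" for A B x y z h11 h12 h22 :: real
    by algebra
  have "det (hess Gh phi p) = ?A * ?B^2 * (beta_form G p $ 3)^2"
    using det[of ?A "beta_form G p $ 1" ?B "H (base_pt p) $ 1 $ 1" "beta_form G p $ 2"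
        "H (base_pt p) $ 2 $ 2" "beta_form G p $ 3" "H (base_pt p) $ 1 $ 2"]
      hess_phi(1)[OF p, of 1 1] hess_phi(1)[OF p, of 1 2] hess_phi(1)[OF p, of 2 1]
      hess_phi(1)[OF p, of 2 2] hess_phi(2,3)[OF p] sym_H[OF u(1), of 2 1] H
    by (simp add: det_3)
  \<comment> \<open>The product contains the cube of \<open>cfun p\<close>, which is the denominator
    \<open>C - rad p ^ 3\<close> of \<open>?A\<close>.\<close>
  also have "?A * ?B^2 = (?w * ?r ^ 3)^2"
  proof -
    have "q * r ^ 4 * (q * r * w)^2 = (w * r ^ 3)^2 * q ^ 3" for q r w :: real by algebra
    from this[of ?q ?r ?w] show ?thesis
      unfolding cube_root_cube[OF sub_pos[OF p]]
      by (simp only: times_divide_eq_left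
          nonzero_mult_div_cancel_right[OF sub_pos[OF p, THEN less_imp_neq, THEN not_sym]])
  qed
  also have "\<dots> * (beta_form G p $ 3)^2 = (p $ 3) ^ 4"
    using u(2) unfolding rad_cube[OF pb]
    by (simp add: beta_form_nth power_divide power_mult[symmetric] field_simps)
  finally show ?thesis .
qed

text \<open>The form is a positive multiple of the square of beta plus a positive multiple of
  \<open>H\<close> on the base part. A nonzero vector with vanishing base part is vertical, and beta
  does not annihilate it.\<close>

lemma hess_phi_pos:
  assumes p: "p \<in> sub C" and v: "v \<noteq> 0"
  shows "v \<bullet> (hess Gh phi p *v v) > 0"
proof -
  note u = UhatD[OF subD(1)[OF p]]
  let ?H = "H (base_pt p)"
  define A where "A = cfun p * rad p ^ 4 / (C - rad p ^ 3)"
  define B where "B = cfun p * rad p * (- W (base_pt p) / 2)"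
  note AB = hess_phi_coefficients[OF p, folded A_def B_def]
  note h = hess_phi[OF p, folded A_def B_def]
  have eq: "v \<bullet> (hess Gh phi p *v v) = A * (beta_form G p \<bullet> v)^2 + B * (base_pt v \<bullet> (?H *v base_pt v))"
    by (simp add: inner_vec_def matrix_vector_mult_def sum_3 sum_2 base_pt_nth power2_eq_square
        h(1)[of 1 1, unfolded hidx_simps] h(1)[of 1 2, unfolded hidx_simps]
        h(1)[of 2 1, unfolded hidx_simps] h(1)[of 2 2, unfolded hidx_simps] h(2,3))
      (simp add: algebra_simps)
  show ?thesis
  proof (cases "base_pt v = 0")
    case True
    then have "v $ hidx a = 0" for a by (metis base_pt_nth zero_index)
    moreover have "v $ 3 \<noteq> 0" using v calculation by (auto simp: vec_eq_iff all_hidx)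
    ultimately have "beta_form G p \<bullet> v \<noteq> 0"
      using u(2) by (simp add: inner_vec_def sum_hidx beta_form_nth)
    then show ?thesis unfolding eq using AB(1) True by simp
  next
    case False
    then have "B * (base_pt v \<bullet> (?H *v base_pt v)) > 0"
      using pos_H[OF u(1)] AB(2) mult_pos_pos by blast
    moreover have "A * (beta_form G p \<bullet> v)^2 \<ge> 0" using AB(1) by simp
    ultimately show ?thesis unfolding eq by linarith
  qed
qed

end

section \<open>The trace of the Thomas connection and parallel volume forms\<close>

lemma conn_trace_Gh:
  assumes p: "p \<in> Uhat"
  shows "conn_trace Gh i p = (if i = 3 then 2 / p $ 3 else 0)"
  using exhaust_2 by (cases i rule: hidx_cases)
    (auto simp: conn_trace_def[of Gh] sum_hidx Gh_sym[OF p] Gh_base[OF p] Gh_euler[OF p] Proj_def sum_2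
      conn_trace_def[of G] field_simps)

text \<open>By \<open>conn_trace_Gh\<close>, \<open>\<mu>\<close> has the same logarithmic
  derivative as the square of the fibre coordinate. Hence the logarithm has zero gradient on all of
  \<open>V\<close>, which avoids integrating the equation for \<open>\<mu>\<close>.\<close>

lemma hess_ln_parallel:
  assumes V: "open V" "V \<subseteq> Uhat" and p: "p \<in> V"
    and \<mu>: "smooth_on V \<mu>" "\<And>q. q \<in> V \<Longrightarrow> \<mu> q \<noteq> 0"
      "\<And>q i. q \<in> V \<Longrightarrow> pd i \<mu> q = conn_trace Gh i q * \<mu> q"
    and f: "\<And>q. q \<in> V \<Longrightarrow> f q = (q $ 3) ^ 4"
  shows "hess Gh (\<lambda>q. ln \<bar>f q / (\<mu> q)^2\<bar>) p = 0"
proof -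
  have zero: "pd i (\<lambda>q. ln \<bar>f q / (\<mu> q)^2\<bar>) q = 0" if q: "q \<in> V" for i q
  proof -
    have s: "q $ 3 \<noteq> 0" if "q \<in> V" for q using V that UhatD by blast
    have ds: "(\<lambda>q. (q $ 3) ^ 4) differentiable (at q)"
      by (intro differentiable_power differentiable_fibre)
    have d\<mu>: "\<mu> differentiable (at q)" by (rule smooth_on_differentiable[OF \<mu>(1) q])
    have d\<mu>2: "(\<lambda>q. \<mu> q * \<mu> q) differentiable (at q)" by (intro differentiable_mult d\<mu>)
    have pos: "(q $ 3) ^ 4 > 0" "\<mu> q * \<mu> q > 0"
      using s[OF q] \<mu>(2)[OF q] by (auto simp: zero_less_mult_iff)
    have "pd i (\<lambda>q. ln \<bar>f q / (\<mu> q)^2\<bar>) q = pd i (\<lambda>q. ln ((q $ 3) ^ 4) - ln (\<mu> q * \<mu> q)) q"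
      by (rule pd_cong[OF V(1) q])
        (use s \<mu>(2) in \<open>simp add: f abs_div_pos ln_div power2_eq_square[symmetric]\<close>)
    also have "\<dots> = pd i (\<lambda>q. ln ((q $ 3) ^ 4)) q - pd i (\<lambda>q. ln (\<mu> q * \<mu> q)) q"
      by (rule pd_diff) (use has_derivative_ln[OF pos(1) differentiable_has_derivative[OF ds]]
        has_derivative_ln[OF pos(2) differentiable_has_derivative[OF d\<mu>2]]
        in \<open>auto simp: differentiable_def\<close>)
    also have "\<dots> = pd i (\<lambda>q. (q $ 3) ^ 4) q / (q $ 3) ^ 4 - 2 * pd i \<mu> q / \<mu> q"
      using \<mu>(2)[OF q] by (simp add: pd_ln[OF ds pos(1)] pd_ln[OF d\<mu>2 pos(2)] pd_mult d\<mu>)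
    also have "pd i (\<lambda>q. (q $ 3) ^ 4) q = (if i = 3 then 4 * (q $ 3) ^ 3 else 0)"
      unfolding power4_eq_xxxx power3_eq_cube
      by (simp add: pd_mult differentiable_fibre pd_fibre)
    finally show ?thesis
      using \<mu>(2)[OF q] s[OF q] conn_trace_Gh[of q i] V q
      by (simp add: \<mu>(3)[OF q] subset_iff power3_eq_cube power4_eq_xxxx)
  qed
  have zero2: "pd i (pd j (\<lambda>q. ln \<bar>f q / (\<mu> q)^2\<bar>)) p = pd i (\<lambda>_. 0) p" for i j
    by (rule pd_cong[OF V(1) p zero])
  show ?thesis unfolding vec_eq_iff hess_nth zero[OF p] zero2 pd_const by simp
qed

end

section \<open>The cube root bundle as a manifold\<close>

text \<open>The real cube root of $1/d$ for either sign of $d$, written in a form that is visibly smooth.\<close>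

definition inv_cbrt :: "real \<Rightarrow> real" where
  "inv_cbrt d = d * (d * d) powr (- 2/3)"

lemma inv_cbrt_cube: "d \<noteq> 0 \<Longrightarrow> inv_cbrt d ^ 3 * d = 1"
proof -
  assume d: "d \<noteq> 0"
  have "((d * d) powr (- 2/3)) ^ 3 = 1 / (d * d)^2"
    using d by (subst powr_power) (auto simp: powr_minus_divide)
  moreover have "inv_cbrt d ^ 3 * d = ((d * d) powr (- 2/3)) ^ 3 * (d * d)^2"
    unfolding inv_cbrt_def by algebra
  ultimately show ?thesis using d by simp
qed

lemma smooth_on_inv_cbrt:
  fixes f :: "'e::euclidean_space \<Rightarrow> real"
  assumes "open S" "smooth_on S f" "\<And>x. x \<in> S \<Longrightarrow> f x \<noteq> 0"
  shows "smooth_on S (\<lambda>x. inv_cbrt (f x))"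
  unfolding inv_cbrt_def
  by (intro smooth_on_mult smooth_on_powr assms(1,2)) (use assms(3) in \<open>simp add: zero_less_mult_iff, force\<close>)

lemma cube_eq_iff: "a ^ 3 = b ^ 3 \<longleftrightarrow> a = (b::real)"
  by (metis odd_numeral odd_real_root_power_cancel)

lemma hat_atlas_simps [simp]:
  "chart_ids (hat_atlas A) = chart_ids A"
  "chart_dom (hat_atlas A) i = {(x, \<theta>) \<in> Mhat A. x \<in> chart_dom A i}"
  by (simp_all add: hat_atlas_def)

lemma coord_hat:
  "base_pt (coord (hat_atlas A) i (x, \<theta>)) = coord A i x"
  "coord (hat_atlas A) i (x, \<theta>) $ 3 = \<theta> i"
  by (simp_all add: hat_atlas_def base_pt_def vec_eq_iff forall_2)

lemma hat_point_eqI: "base_pt p = base_pt q \<Longrightarrow> p $ 3 = q $ 3 \<Longrightarrow> p = q"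
  by (simp add: vec_eq_iff all_hidx base_pt_nth)

lemma Mhat_cube:
  assumes "(x, \<theta>) \<in> Mhat A" "i \<in> chart_ids A" "j \<in> chart_ids A" "x \<in> chart_dom A i" "x \<in> chart_dom A j"
  shows "\<theta> i ^ 3 = det (trans_jac A i j (coord A i x)) * \<theta> j ^ 3"
proof -
  have "cube \<theta> \<in> det_fibre A x" using assms(1) by (simp add: Mhat_def)
  then have "cube \<theta> i = det (trans_jac A i j (coord A i x)) * cube \<theta> j"
    using assms(2-5) unfolding det_fibre_def by blast
  then show ?thesis by (simp add: cube_def)
qed

lemma Mhat_outside:
  assumes "(x, \<theta>) \<in> Mhat A" "\<not> (i \<in> chart_ids A \<and> x \<in> chart_dom A i)"
  shows "\<theta> i = 0"
proof -
  have "cube \<theta> \<in> det_fibre A x" using assms(1) by (simp add: Mhat_def)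
  then have "cube \<theta> i = 0" using assms(2) unfolding det_fibre_def by blast
  then show ?thesis by (simp add: cube_def)
qed

text \<open>Some component is nonzero, and the transformation law would make it vanish if the
  component in chart \<open>i\<close> did.\<close>

lemma Mhat_nonzero:
  assumes "(x, \<theta>) \<in> Mhat A" "i \<in> chart_ids A" "x \<in> chart_dom A i"
  shows "\<theta> i \<noteq> 0"
proof -
  have "\<exists>k. \<theta> k \<noteq> 0" using assms(1) by (auto simp: Mhat_def cube_def fun_eq_iff)
  then obtain k where k: "\<theta> k \<noteq> 0" by blast
  then have "k \<in> chart_ids A" "x \<in> chart_dom A k" using Mhat_outside[OF assms(1)] by blast+
  from Mhat_cube[OF assms(1) this(1) assms(2) this(2) assms(3)] k show ?thesis by auto
qed

text \<open>Real cube roots are unique, so the law for the cubes fixes the law for the roots; this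
  is the fibre part of the transition map.\<close>

lemma Mhat_change:
  assumes "smooth_atlas A" "(x, \<theta>) \<in> Mhat A" "i \<in> chart_ids A" "j \<in> chart_ids A"
    "x \<in> chart_dom A i" "x \<in> chart_dom A j"
  shows "\<theta> j = \<theta> i * inv_cbrt (det (trans_jac A i j (coord A i x)))"
proof -
  let ?d = "det (trans_jac A i j (coord A i x))"
  have "inv_cbrt ?d ^ 3 * ?d = 1"
    by (rule inv_cbrt_cube[OF det_trans_jac_nonzero[OF assms(1,3-6)]])
  then have "\<theta> j ^ 3 = (\<theta> i * inv_cbrt ?d) ^ 3"
    unfolding power_mult_distrib Mhat_cube[OF assms(2-6)] by algebra
  then show ?thesis by (simp only: cube_eq_iff)
qed

lemma Mhat_eqI:
  assumes "smooth_atlas A" "(x, \<theta>) \<in> Mhat A" "(x, \<theta>') \<in> Mhat A" "i \<in> chart_ids A" "x \<in> chart_dom A i"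
    "\<theta> i = \<theta>' i"
  shows "\<theta> = \<theta>'"
proof
  fix j
  show "\<theta> j = \<theta>' j"
    using Mhat_change[OF assms(1,2,4) _ assms(5), of j] Mhat_change[OF assms(1,3,4) _ assms(5), of j]
      Mhat_outside[OF assms(2), of j] Mhat_outside[OF assms(3), of j] assms(6)
    by (cases "j \<in> chart_ids A \<and> x \<in> chart_dom A j") auto
qed

text \<open>The value \<open>s\<close> in chart \<open>i\<close> is propagated to the other charts
  around \<open>x\<close> by \<open>inv_cbrt\<close>; the cocycle law for Jacobians makes the cubes
  of these values consistent.\<close>

lemma Mhat_exists:
  assumes A: "smooth_atlas A" and i: "i \<in> chart_ids A" and x: "x \<in> chart_dom A i" and s: "s \<noteq> 0"
  shows "\<exists>\<theta>. (x, \<theta>) \<in> Mhat A \<and> \<theta> i = s"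
proof -
  let ?d = "\<lambda>j. det (trans_jac A i j (coord A i x))"
  let ?\<theta> = "\<lambda>j. if j \<in> chart_ids A \<and> x \<in> chart_dom A j then s * inv_cbrt (?d j) else 0"
  have i1: "?\<theta> i = s"
    using i x trans_jac_self[OF A i x] by (simp add: inv_cbrt_def)
  have law: "?\<theta> j ^ 3 = det (trans_jac A j k (coord A j x)) * ?\<theta> k ^ 3"
    if jk: "j \<in> chart_ids A" "k \<in> chart_ids A" "x \<in> chart_dom A j" "x \<in> chart_dom A k" for j k
  proof -
    let ?e = "det (trans_jac A j k (coord A j x))"
    have "?d k = ?e * ?d j"
      using trans_jac_cocycle[OF A i jk(1,2) x jk(3,4)] by (simp add: det_mul)
    moreover have "inv_cbrt (?d j) ^ 3 * ?d j = 1" "inv_cbrt (?d k) ^ 3 * ?d k = 1"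
      using inv_cbrt_cube det_trans_jac_nonzero[OF A i _ x] jk by blast+
    ultimately have "inv_cbrt (?d j) ^ 3 = ?e * inv_cbrt (?d k) ^ 3" by algebra
    then show ?thesis using jk by (simp add: power_mult_distrib)
  qed
  have "cube ?\<theta> \<in> det_fibre A x"
    unfolding det_fibre_def mem_Collect_eq cube_def by (intro conjI allI ballI impI law) auto
  moreover have "cube ?\<theta> i \<noteq> 0" using i1 s by (simp add: cube_def)
  then have "cube ?\<theta> \<noteq> (\<lambda>_. 0)" by metis
  moreover have "x \<in> carrier A" using i x by (auto simp: carrier_def)
  ultimately have "(x, ?\<theta>) \<in> Mhat A" unfolding Mhat_def by blast
  with i1 show ?thesis by blast
qed

lemma img_hat:
  assumes A: "smooth_atlas A" and i: "i \<in> chart_ids A"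
  shows "img (hat_atlas A) {(x, \<theta>) \<in> Mhat A. x \<in> X} i = {p. base_pt p \<in> img A X i \<and> p $ 3 \<noteq> 0}"
proof (intro set_eqI iffI)
  fix p assume "p \<in> img (hat_atlas A) {(x, \<theta>) \<in> Mhat A. x \<in> X} i"
  then show "p \<in> {p. base_pt p \<in> img A X i \<and> p $ 3 \<noteq> 0}"
    using Mhat_nonzero[OF _ i] by (auto simp: img_def coord_hat)
next
  fix p assume "p \<in> {p. base_pt p \<in> img A X i \<and> p $ 3 \<noteq> 0}"
  then obtain x where x: "x \<in> chart_dom A i" "x \<in> X" "base_pt p = coord A i x" "p $ 3 \<noteq> 0"
    by (auto simp: img_def)
  obtain \<theta> where "(x, \<theta>) \<in> Mhat A" "\<theta> i = p $ 3" using Mhat_exists[OF A i x(1,4)] by blast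
  moreover from this have "p = coord (hat_atlas A) i (x, \<theta>)"
    by (intro hat_point_eqI) (simp_all add: coord_hat x)
  ultimately show "p \<in> img (hat_atlas A) {(x, \<theta>) \<in> Mhat A. x \<in> X} i"
    using x by (auto simp: img_def)
qed

lemma carrier_hat: "carrier (hat_atlas A) = Mhat A"
  by (auto simp: carrier_def Mhat_def)

lemma Mhat_eq: "Mhat A = {(x, \<theta>) \<in> Mhat A. x \<in> carrier A}"
  by (auto simp: Mhat_def)

lemma img_hat_Mhat:
  "smooth_atlas A \<Longrightarrow> i \<in> chart_ids A \<Longrightarrow>
    img (hat_atlas A) (Mhat A) i = {p. base_pt p \<in> img A (carrier A) i \<and> p $ 3 \<noteq> 0}"
  by (rule img_hat[of A i "carrier A", folded Mhat_eq])

text \<open>A transition is that of the base together with multiplication of the fibre coordinate by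
  the cube root of the inverse Jacobian determinant, smooth because the determinant has no
  zero.\<close>

lemma smooth_atlas_hat:
  assumes A: "smooth_atlas A"
  shows "smooth_atlas (hat_atlas A)"
proof -
  note inj = smooth_atlas_inj[OF A]
  have inj_hat: "inj_on (coord (hat_atlas A) i) (chart_dom (hat_atlas A) i)" if i: "i \<in> chart_ids A" for i
  proof (rule inj_onI, clarsimp)
    fix x \<theta> x' \<theta>'
    assume *: "coord (hat_atlas A) i (x, \<theta>) = coord (hat_atlas A) i (x', \<theta>')"
      "(x, \<theta>) \<in> Mhat A" "(x', \<theta>') \<in> Mhat A" "x \<in> chart_dom A i" "x' \<in> chart_dom A i"
    then have "coord A i x = coord A i x'" "\<theta> i = \<theta>' i" using coord_hat by metis+
    then show "x = x' \<and> \<theta> = \<theta>'"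
      using * Mhat_eqI[OF A, of x \<theta> \<theta>' i] i inj[OF i] by (auto dest: inj_onD)
  qed
  have region: "img (hat_atlas A) (chart_dom (hat_atlas A) j) i
      = {p. base_pt p \<in> img A (chart_dom A j) i \<and> p $ 3 \<noteq> 0}"
    if "i \<in> chart_ids A" "j \<in> chart_ids A" for i j
    using img_hat[OF A that(1), of "chart_dom A j"] by simp
  have op: "open (img (hat_atlas A) (chart_dom (hat_atlas A) j) i)"
    if "i \<in> chart_ids A" "j \<in> chart_ids A" for i j
    unfolding region[OF that] by (intro open_hat_region smooth_atlas_open_overlap A that)
  have sm: "smooth_on (img (hat_atlas A) (chart_dom (hat_atlas A) j) i) (transition (hat_atlas A) i j)"
    if i: "i \<in> chart_ids A" and j: "j \<in> chart_ids A" for i j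
  proof -
    let ?X = "img A (chart_dom A j) i"
    let ?S = "{p. base_pt p \<in> ?X \<and> p $ 3 \<noteq> 0}"
    let ?d = "\<lambda>u. det (trans_jac A i j u)"
    have X: "open ?X" by (rule smooth_atlas_open_overlap[OF A i j])
    note S = open_hat_region[OF X]
    have tr: "base_pt (transition (hat_atlas A) i j p) = transition A i j (base_pt p)"
      "transition (hat_atlas A) i j p $ 3 = p $ 3 * inv_cbrt (?d (base_pt p))"
      if "p \<in> ?S" for p
    proof -
      obtain x \<theta> where x: "(x, \<theta>) \<in> Mhat A" "x \<in> chart_dom A i" "x \<in> chart_dom A j"
        and p: "p = coord (hat_atlas A) i (x, \<theta>)"
        using \<open>p \<in> ?S\<close> unfolding region[OF i j, symmetric] by (auto simp: img_def)
      have "transition (hat_atlas A) i j p = coord (hat_atlas A) j (x, \<theta>)"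
        unfolding p using x by (intro transition_coord inj_hat i) auto
      then show "base_pt (transition (hat_atlas A) i j p) = transition A i j (base_pt p)"
        "transition (hat_atlas A) i j p $ 3 = p $ 3 * inv_cbrt (?d (base_pt p))"
        using Mhat_change[OF A x(1) i j x(2,3)] transition_coord[OF inj[OF i] x(2)]
        by (simp_all add: p coord_hat)
    qed
    have d0: "?d u \<noteq> 0" if "u \<in> ?X" for u
      using that det_trans_jac_nonzero[OF A i j] by (auto simp: img_def)
    have sd: "smooth_on ?X ?d"
      unfolding det_2 by (intro smooth_on_diff smooth_on_mult smooth_on_trans_jac X A i j)
    have "smooth_on ?S (\<lambda>p. transition (hat_atlas A) i j p $ k)" for k
    proof (cases k rule: hidx_cases)
      case (1 a)
      have *: "smooth_on ?S (\<lambda>p. transition A i j (base_pt p) $ a)"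
        by (intro smooth_on_component S smooth_on_compose_base_pt X smooth_on_transition A i j)
      show ?thesis
        by (rule smooth_on_cong[OF S _ *]) (simp only: 1 base_pt_nth[symmetric] tr(1))
    next
      case 2
      have "smooth_on ?S (\<lambda>p. inv_cbrt (?d (base_pt p)))"
        by (rule smooth_on_compose_base_pt[OF X smooth_on_inv_cbrt[OF X sd d0]])
      moreover have "smooth_on ?S (\<lambda>p. p $ 3)"
        by (rule smooth_on_component[OF S smooth_on_ident[OF S]])
      ultimately have *: "smooth_on ?S (\<lambda>p. p $ 3 * inv_cbrt (?d (base_pt p)))"
        by (intro smooth_on_mult S)
      show ?thesis
        by (rule smooth_on_cong[OF S _ *]) (simp only: 2 tr(2))
    qed
    then show ?thesis unfolding region[OF i j] by (rule smooth_on_vec[OF S])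
  qed
  have "open (coord (hat_atlas A) i ` chart_dom (hat_atlas A) i)" if "i \<in> chart_ids A" for i
    using op[OF that that] by (simp add: img_def)
  then show ?thesis unfolding smooth_atlas_def hat_atlas_simps(1) using inj_hat op sm by blast
qed

section \<open>The chart data of an exact Einstein structure\<close>

lemma posdef_2_det:
  fixes M :: "real^2^2"
  assumes "M $ 1 $ 2 = M $ 2 $ 1" "\<And>v. v \<noteq> 0 \<Longrightarrow> v \<bullet> (M *v v) > 0"
  shows "det M > 0"
proof -
  have m11: "M $ 1 $ 1 > 0"
    using assms(2)[of "vector [1, 0]"]
    by (simp add: inner_vec_def matrix_vector_mult_def sum_2 vec_eq_iff forall_2)
  \<comment> \<open>On this vector the quadratic form takes the value
    \<open>M $ 1 $ 1 * det M\<close>.\<close>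
  have "vector [- M $ 1 $ 2, M $ 1 $ 1] \<noteq> (0 :: real^2)"
    using m11 by (simp add: vec_eq_iff forall_2)
  from assms(2)[OF this] have "M $ 1 $ 1 * det M > 0"
    using assms(1) by (simp add: inner_vec_def matrix_vector_mult_def sum_2 det_2 algebra_simps)
  then show ?thesis using m11 by (simp add: zero_less_mult_iff)
qed

text \<open>For symmetric Christoffel symbols the quadratic terms cancel, leaving the curvature of
  the induced connection on densities. It vanishes once the trace is closed.\<close>

lemma ricci_skew_eq:
  fixes G :: "2 christoffel"
  assumes U: "open U" "u \<in> U"
    and d: "\<And>a b c. (\<lambda>u. G u $ a $ b $ c) differentiable (at u)"
    and sym: "\<And>u a b c. u \<in> U \<Longrightarrow> G u $ a $ b $ c = G u $ b $ a $ c"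
  shows "ricci_skew G i j u = (pd j (conn_trace G i) u - pd i (conn_trace G j) u) / 2"
proof -
  have tr: "pd a (conn_trace G b) u = (\<Sum>p\<in>UNIV. pd a (\<lambda>u. G u $ b $ p $ p) u)" for a b
    unfolding conn_trace_def[abs_def] by (rule pd_sum) (rule d)
  have s: "G u $ 2 $ 1 $ c = G u $ 1 $ 2 $ c"
    "pd a (\<lambda>u. G u $ 2 $ 1 $ c) u = pd a (\<lambda>u. G u $ 1 $ 2 $ c) u" for a c
    by (rule sym[OF U(2)]) (rule pd_cong[OF U sym])
  have "\<forall>i j. ricci_skew G i j u = (pd j (conn_trace G i) u - pd i (conn_trace G j) u) / 2"
    by (simp add: forall_2 ricci_skew_def ricci_def curvature_def sum_2 tr s field_simps)
  then show ?thesis by blast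
qed

lemma exact_einstein_chart_exists:
  fixes A :: "('i, 'a, 2) atlas"
  assumes A: "smooth_atlas A"
    and AH: "AH_structure A P K"
    and signature: "riemannian_on A (carrier A) h"
    and aligned: "aligned_rep A P h nabla"
    and exact: "exact_AH A K nabla"
    and einstein: "einstein_AH A h nabla"
    and negative: "\<forall>i\<in>chart_ids A. \<forall>u\<in>img A (carrier A) i. weighted_scal (h i) (nabla i) u < 0"
    and thomas: "thomas_connection A nabla nabla_hat"
    and i: "i \<in> chart_ids A"
  shows "\<exists>L. exact_einstein_chart (img A (carrier A) i) (nabla i) (unimod (h i))
    (weighted_scal (h i) (nabla i)) L (nabla_hat i)"
proof -
  define U where "U = img A (carrier A) i"
  define G where "G = nabla i"
  define H where "H = unimod (h i)"
  define W where "W = weighted_scal (h i) (nabla i)"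
  have oU: "open U" unfolding U_def by (rule smooth_atlas_open_carrier[OF A i])
  have conn: "affine_connection A nabla" "torsion_free A nabla"
    using AH aligned unfolding AH_structure_def projective_structure_def aligned_rep_def by blast+
  have sG: "smooth_on U (\<lambda>u. G u $ a $ b $ c)" for a b c
    unfolding U_def G_def by (rule affine_connection_smooth[OF conn(1) i oU[unfolded U_def]])
  have symG: "G u $ a $ b $ c = G u $ b $ a $ c" if "u \<in> U" for u a b c
    using conn(2) i that by (simp add: torsion_free_def U_def G_def)
  have dG: "(\<lambda>u. G u $ a $ b $ c) differentiable (at u)" if "u \<in> U" for u a b c
    by (rule smooth_on_differentiable[OF sG that])

  have h: "smooth_on U (h i)" "\<And>u. u \<in> U \<Longrightarrow> transpose (h i u) = h i u"
    "\<And>u v. u \<in> U \<Longrightarrow> v \<noteq> 0 \<Longrightarrow> v \<bullet> (h i u *v v) > 0"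
    using signature i by (auto simp: riemannian_on_def metric_on_def U_def)
  have hsym: "h i u $ a $ b = h i u $ b $ a" if "u \<in> U" for u a b
  proof -
    have "transpose (h i u) $ b $ a = h i u $ b $ a" using h(2)[OF that] by simp
    then show ?thesis by (simp add: transpose_def)
  qed
  have hdet: "det (h i u) > 0" if "u \<in> U" for u
    using posdef_2_det[OF hsym[OF that] h(3)[OF that]] by blast
  have sh: "smooth_on U (\<lambda>u. h i u $ a $ b)" for a b
    by (intro smooth_on_component oU h(1))
  have sdet: "smooth_on U (\<lambda>u. det (k u))" if "\<And>a b. smooth_on U (\<lambda>u. k u $ a $ b)"
    for k :: "real^2 \<Rightarrow> real^2^2"
    unfolding det_2 by (intro smooth_on_diff smooth_on_mult oU that)
  have H_nth: "H u $ a $ b = det (h i u) powr (-1/2) * h i u $ a $ b" if "u \<in> U" for u a b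
    using hdet[OF that] by (simp add: H_def unimod_def)
  have sH: "smooth_on U (\<lambda>u. H u $ a $ b)" for a b
  proof (rule smooth_on_cong[OF oU H_nth[symmetric]])
    show "smooth_on U (\<lambda>u. det (h i u) powr (-1/2) * h i u $ a $ b)"
      by (intro smooth_on_mult smooth_on_powr sdet sh oU hdet)
  qed
  have symH: "H u $ a $ b = H u $ b $ a" if "u \<in> U" for u a b
    using hsym[OF that] by (simp add: H_nth[OF that])
  have posH: "v \<bullet> (H u *v v) > 0" if "u \<in> U" "v \<noteq> 0" for u v
  proof -
    have "v \<bullet> (H u *v v) = det (h i u) powr (-1/2) * (v \<bullet> (h i u *v v))"
      using hdet[OF that(1)] by (simp add: H_def unimod_def scaleR_matrix_vector_assoc[symmetric])
    then show ?thesis using h(3)[OF that] hdet[OF that(1)] by simp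
  qed
  have detH: "det (H u) = 1" if u: "u \<in> U" for u
  proof -
    have "det (H u) = (det (h i u) powr (-1/2) * det (h i u) powr (-1/2)) * det (h i u)"
      unfolding det_2[of "H u"] H_nth[OF u] det_2[of "h i u"] by algebra
    also have "\<dots> = 1" using hdet[OF u] by (simp add: powr_add[symmetric] powr_neg_one)
    finally show ?thesis .
  qed

  have ein: "ricci_sym G a b u = W u / 2 * H u $ a $ b"
    "cov_density G 1 W a u + 2 * (\<Sum>p\<in>UNIV. \<Sum>q\<in>UNIV. matrix_inv (H u) $ p $ q *
        cov_tensor2 G 0 (\<lambda>v. \<chi> r s. faraday G r s v) q a p u) = 0"
    if "u \<in> U" for u a b
    using einstein i that unfolding einstein_AH_def G_def H_def W_def U_def by blast+
  have negW: "W u < 0" if "u \<in> U" for u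
    using negative i that by (simp add: W_def U_def)
  have sric: "smooth_on U (\<lambda>u. ricci_sym G a b u)" for a b
    unfolding ricci_sym_def ricci_def curvature_def
    by (intro smooth_on_divide_const smooth_on_add smooth_on_sum smooth_on_diff smooth_on_mult
        smooth_on_pd sG oU)
  \<comment> \<open>Smoothness of \<open>W\<close> is obtained without the inverse matrix in its
    definition: as \<open>det (H u) = 1\<close>, the determinant of the Ricci form is the square of
    \<open>W u / 2\<close>, and negativity of \<open>W\<close> selects the root.\<close>
  let ?D = "\<lambda>u. ricci_sym G 1 1 u * ricci_sym G 2 2 u - ricci_sym G 1 2 u * ricci_sym G 1 2 u"
  have D: "?D u = (W u / 2)^2" if u: "u \<in> U" for u
  proof -
    have "?D u = (W u / 2)^2 * det (H u)"
      unfolding ein(1)[OF u] det_2 symH[OF u, of 2 1] by (simp add: power2_eq_square algebra_simps)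
    then show ?thesis using detH[OF u] by simp
  qed
  have sW: "smooth_on U W"
  proof (rule smooth_on_cong[OF oU])
    show "smooth_on U (\<lambda>u. - 2 * (?D u) powr (1/2))"
      by (intro smooth_on_mult smooth_on_const smooth_on_powr smooth_on_diff sric oU)
        (use D negW in \<open>force simp: zero_less_power2\<close>)
    show "- 2 * (?D u) powr (1/2) = W u" if "u \<in> U" for u
      unfolding D[OF that] using negW[OF that] by (simp add: powr_half_sqrt)
  qed

  obtain h' where h': "h' \<in> K"
    "\<And>u a. u \<in> U \<Longrightarrow> cov_density G 2 (\<lambda>v. \<bar>det (h' i v)\<bar>) a u = 0"
    using exact i unfolding exact_AH_def U_def G_def by blast
  have "metric_on A (carrier A) h'"
    using h'(1) AH unfolding AH_structure_def conformal_structure_def by blast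
  then have m': "smooth_on U (h' i)" "\<And>u. u \<in> U \<Longrightarrow> det (h' i u) \<noteq> 0"
    using i by (auto simp: metric_on_def U_def)
  let ?E = "\<lambda>u. det (h' i u) * det (h' i u)"
  \<comment> \<open>The determinant is a density of weight 2, so the trace is half the differential
    of the logarithm of its absolute value; squaring removes the absolute value and turns 1/2 into
    1/4.\<close>
  define L where "L u = ln (?E u) / 4" for u
  have sE: "smooth_on U ?E"
    by (intro smooth_on_mult sdet smooth_on_component oU m'(1))
  have E: "?E u > 0" if "u \<in> U" for u
    using m'(2)[OF that] by (simp add: zero_less_mult_iff) linarith
  have sL: "smooth_on U L"
    unfolding L_def[abs_def] by (intro smooth_on_divide_const smooth_on_ln sE E oU)
  have trL: "conn_trace G a u = pd a L u" if u: "u \<in> U" for u a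
  proof -
    have dE: "?E differentiable (at u)" by (rule smooth_on_differentiable[OF sE u])
    have dl: "(\<lambda>u. ln (?E u)) differentiable (at u)"
      by (rule smooth_on_differentiable[OF smooth_on_ln[OF oU sE E] u])
    have abs: "\<bar>det (h' i v)\<bar> = ?E v powr (1/2)" for v
      by (simp add: powr_half_sqrt)
    have "pd a (\<lambda>v. ?E v powr (1/2)) u = 2 * conn_trace G a u * ?E u powr (1/2)"
      using h'(2)[OF u, of a] unfolding abs by (simp add: cov_density_def)
    then have "?E u powr (1/2) * (pd a ?E u / ?E u / 2) = ?E u powr (1/2) * (2 * conn_trace G a u)"
      unfolding pd_powr[OF dE E[OF u]] by (simp add: mult_ac)
    moreover have "?E u powr (1/2) \<noteq> 0" using m'(2)[OF u] by simp
    ultimately have "pd a ?E u / ?E u / 2 = 2 * conn_trace G a u"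
      by (rule mult_left_cancel[THEN iffD1, rotated])
    then show ?thesis
      unfolding L_def[abs_def] pd_divide_const[OF dl] pd_ln[OF dE E[OF u]] by simp
  qed

  have closed: "pd a (conn_trace G b) u = pd b (conn_trace G a) u" if "u \<in> U" for u a b
    using pd_cong[OF oU that, of "conn_trace G a" "pd a L" b]
      pd_cong[OF oU that, of "conn_trace G b" "pd b L" a] trL pd_commute[OF oU sL that, of a b] by simp
  have skew: "ricci_skew G a b u = 0" if "u \<in> U" for u a b
    by (subst ricci_skew_eq[OF oU that dG[OF that] symG]) (simp_all add: closed[OF that, of a b])
  have ric: "ricci G a b u = W u / 2 * H u $ a $ b" if "u \<in> U" for u a b
    using ein(1)[OF that, of a b] skew[OF that, of a b]
    by (simp add: ricci_sym_def ricci_skew_def)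
  \<comment> \<open>Closedness of the trace makes \<open>faraday\<close> vanish identically, so the
    second Einstein equation reduces to parallelism of \<open>W\<close>.\<close>
  have "cov_tensor2 G 0 (\<lambda>v. \<chi> r s. faraday G r s v) q a p u = 0" if u: "u \<in> U" for u q a p
    using pd_cong[OF oU u, of "\<lambda>v. faraday G a p v" "\<lambda>_. 0" q] skew u
    by (simp add: cov_tensor2_def faraday_def pd_const)
  then have parW: "pd a W u = conn_trace G a u * W u" if "u \<in> U" for u a
    using ein(2)[OF that, of a] that by (simp add: cov_density_def)
  have cod: "cov_tensor2 G (-1) H a b c u = cov_tensor2 G (-1) H b a c u" if "u \<in> U" for u a b c
    using aligned i that unfolding aligned_rep_def G_def H_def U_def by blast

  have hat: "p \<in> img (hat_atlas A) (Mhat A) i" if "base_pt p \<in> U" "p $ 3 \<noteq> 0" for p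
    using that img_hat_Mhat[OF A i] by (simp add: U_def)
  have symGh: "nabla_hat i p $ j $ k $ l = nabla_hat i p $ k $ j $ l"
    if "base_pt p \<in> U" "p $ 3 \<noteq> 0" for p j k l
    using thomas hat[OF that] i
    by (simp add: thomas_connection_def torsion_free_def carrier_hat)
  have lifts: "cov_deriv (nabla_hat i) (\<lambda>_. v) euler_field p = v"
    "smooth_on U X \<Longrightarrow> smooth_on U Y \<Longrightarrow>
        cov_deriv (nabla_hat i) (hor_lift G X) (hor_lift G Y) p = hor_lift G (cov_deriv G X Y) p +
          (\<Sum>a\<in>UNIV. \<Sum>b\<in>UNIV. thomas_P G a b (base_pt p) *
              X (base_pt p) $ a * Y (base_pt p) $ b) *\<^sub>R euler_field p"
    if "base_pt p \<in> U" "p $ 3 \<noteq> 0" for p v X Y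
    using thomas hat[OF that] i unfolding thomas_connection_def G_def U_def by blast+
  show ?thesis
    unfolding W_def[symmetric] unfolding U_def[symmetric] G_def[symmetric] H_def[symmetric]
    by (rule exI[of _ L], rule exact_einstein_chart.intro)
      (fact oU sG symG sH symH posH detH sW negW sL trL ric parW cod symGh lifts)+
qed

text \<open>The exponential is the square root of \<open>vtilde\<close>, that is the power
  \<open>- 1/3\<close> of half the absolute value of \<open>Rt x\<close>; dividing \<open>W\<close>
  by the cube of the fibre coordinate turns this into \<open>rad\<close>. Logarithms make the
  comparison linear.\<close>

lemma (in exact_einstein_chart) rad_eq_Ffun:
  assumes p: "p \<in> Uhat" and R: "W (base_pt p) = Rt x * \<bar>p $ 3 ^ 3\<bar>"
  shows "exp (- Ffun Rt x / 3) = rad p"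
proof -
  let ?s = "\<bar>p $ 3\<bar>" and ?w = "- W (base_pt p)"
  have s: "?s > 0" using UhatD[OF p] by simp
  have w: "?w > 0" using neg_W UhatD[OF p] by simp
  have Rw: "\<bar>Rt x\<bar> * ?s ^ 3 = ?w"
    using w by (simp add: R power_abs abs_mult mult_less_0_iff abs_if split: if_splits)
  have R0: "\<bar>Rt x\<bar> > 0" using Rw w by (cases "Rt x = 0") auto
  have "ln ?w = ln \<bar>Rt x\<bar> + 3 * ln ?s"
    unfolding Rw[symmetric] using R0 s by (simp add: ln_mult ln_realpow)
  then have lnR: "ln \<bar>Rt x\<bar> = ln ?w - 3 * ln ?s" by simp
  have "p $ 3 * p $ 3 = ?s * ?s" by simp
  then have lns: "ln (p $ 3 * p $ 3) = ln ?s + ln ?s" using ln_mult_pos[OF s s] by (simp only:)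
  have "ln (rad p) = (ln ?s + ln ?s) / 2 - ln (?w / 2) / 3"
    unfolding rad_def using s w lns by (simp add: ln_mult ln_powr del: ln_mult_pos)
  also have "\<dots> = ln ?s - (ln ?w - ln 2) / 3"
    unfolding ln_divide_pos[OF w zero_less_numeral] by simp
  also have "\<dots> = - Ffun Rt x / 3"
    using R0 by (simp add: Ffun_def vtilde_def ln_mult ln_powr lnR diff_divide_distrib)
  finally show ?thesis using rad_pos[OF p] by (metis exp_ln)
qed

section \<open>Assembly of the chart computations\<close>

theorem theorem11p3:
  fixes A :: "('i, 'a, 2) atlas"
    and P :: "('i, 2) connection set"
    and K :: "('i, 2) tensor2 set"
    and h :: "('i, 2) tensor2"
    and nabla :: "('i, 2) connection"
    and nabla_hat :: "('i, 3) connection"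
    and Rt :: "'a \<times> ('i \<Rightarrow> real) \<Rightarrow> real"
    and C :: real
  assumes surface: "smooth_manifold A"
    and AH: "AH_structure A P K"
    and rep: "h \<in> K"
    and signature: "riemannian_on A (carrier A) h"
    and aligned: "aligned_rep A P h nabla"
    and exact: "exact_AH A K nabla"
    and einstein: "einstein_AH A h nabla"
    and negative: "\<forall>i\<in>chart_ids A. \<forall>u\<in>img A (carrier A) i. weighted_scal (h i) (nabla i) u < 0"
    and thomas: "thomas_connection A nabla nabla_hat"
    and Rt: "lifted_scal A h nabla Rt"
    and C: "C > 0"
  defines "F \<equiv> Ffun Rt"
  defines "\<phi> \<equiv> (\<lambda>p. Psi C (F p))"
  defines "g \<equiv> hess_tensor (hat_atlas A) nabla_hat \<phi>"
  shows "riemannian_on (hat_atlas A) (Mhat_sub A F C) g \<and>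
         monge_ampere_on (hat_atlas A) (Mhat_sub A F C) nabla_hat g"
proof -
  let ?A = "hat_atlas A" and ?M = "Mhat_sub A F C"
  have A: "smooth_atlas A" using surface by (simp add: smooth_manifold_def)
  note A' = smooth_atlas_hat[OF A]
  have \<Gamma>: "affine_connection ?A nabla_hat" "torsion_free ?A nabla_hat"
    using thomas by (simp_all add: thomas_connection_def)
  \<comment> \<open>The potential \<open>L\<close> depends on the chart, so each interpretation of
    the locale stays inside this block and exports only statements without \<open>L\<close>.\<close>
  have chart: "open (img ?A ?M i)" "smooth_on (img ?A ?M i) (local_rep ?A i \<phi>)"
    "\<And>p. p \<in> img ?A ?M i \<Longrightarrow> det (g i p) = (p $ 3) ^ 4 \<and> p $ 3 \<noteq> 0"
    "\<And>p v. p \<in> img ?A ?M i \<Longrightarrow> v \<noteq> 0 \<Longrightarrow> v \<bullet> (g i p *v v) > 0"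
    "\<And>p j k l m. p \<in> img ?A ?M i \<Longrightarrow> curvature (nabla_hat i) j k l m p = 0"
    "\<And>V \<mu> p. open V \<Longrightarrow> V \<subseteq> img ?A ?M i \<Longrightarrow> p \<in> V \<Longrightarrow> smooth_on V \<mu> \<Longrightarrow> (\<And>q. q \<in> V \<Longrightarrow> \<mu> q \<noteq> 0) \<Longrightarrow>
      (\<And>q a. q \<in> V \<Longrightarrow> pd a \<mu> q = conn_trace (nabla_hat i) a q * \<mu> q) \<Longrightarrow>
      hess (nabla_hat i) (\<lambda>q. ln \<bar>det (g i q) / (\<mu> q)^2\<bar>) p = 0"
    if i: "i \<in> chart_ids A" for i
  proof -
    obtain L where "exact_einstein_chart (img A (carrier A) i) (nabla i) (unimod (h i))
        (weighted_scal (h i) (nabla i)) L (nabla_hat i)"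
      using exact_einstein_chart_exists[OF A AH signature aligned exact einstein negative thomas i] by blast
    then interpret E: exact_einstein_chart "img A (carrier A) i" "nabla i" "unimod (h i)"
      "weighted_scal (h i) (nabla i)" L "nabla_hat i" .
    have Uhat: "img ?A (Mhat A) i = E.Uhat"
      by (simp add: img_hat_Mhat[OF A i] E.Uhat_def)
    have rad: "exp (- F y / 3) = E.rad (coord ?A i y)"
      if y: "y \<in> Mhat A" "y \<in> chart_dom ?A i" for y
    proof -
      obtain x \<theta> where xy: "y = (x, \<theta>)" by (cases y)
      have "coord ?A i y \<in> E.Uhat" using coord_in_img[OF y(2,1)] Uhat by simp
      then show ?thesis
        unfolding F_def using Rt y i
        by (intro E.rad_eq_Ffun) (auto simp: xy coord_hat lifted_scal_def cube_def)
    qed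
    \<comment> \<open>Turns the bound on \<open>rad\<close> into one on \<open>F\<close> by
      monotonicity of the exponential.\<close>
    have exp_C: "C powr (1/3) = exp (ln C / 3)" using C by (simp add: powr_def)
    have sub_iff: "E.rad (coord ?A i y) < C powr (1/3) \<longleftrightarrow> F y > - ln C"
      if "y \<in> Mhat A" "y \<in> chart_dom ?A i" for y
      unfolding rad[OF that, symmetric] exp_C by auto
    have img: "img ?A ?M i = E.sub C"
    proof (intro set_eqI iffI)
      fix p assume "p \<in> img ?A ?M i"
      then obtain y where y: "y \<in> chart_dom ?A i" "y \<in> Mhat A" "F y > - ln C" "p = coord ?A i y"
        by (auto simp: img_def Mhat_sub_def)
      then show "p \<in> E.sub C"
        using coord_in_img[OF y(1,2)] sub_iff[OF y(2,1)] Uhat by (simp add: E.sub_def)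
    next
      fix p assume p: "p \<in> E.sub C"
      then have "p \<in> img ?A (Mhat A) i" using Uhat E.subD by blast
      then obtain y where y: "y \<in> chart_dom ?A i" "y \<in> Mhat A" "p = coord ?A i y"
        by (auto simp: img_def)
      have "y \<in> ?M" using E.subD(2)[OF p] sub_iff[OF y(2,1)] y(2,3) by (simp add: Mhat_sub_def)
      then show "p \<in> img ?A ?M i" unfolding y(3) by (rule coord_in_img[OF y(1)])
    qed
    have rep: "local_rep ?A i \<phi> p = profile C (E.rad p)" if "p \<in> E.sub C" for p
    proof -
      from that obtain y where y: "y \<in> chart_dom ?A i" "y \<in> Mhat A" "p = coord ?A i y"
        unfolding img[symmetric] by (auto simp: img_def Mhat_sub_def)
      have "local_rep ?A i \<phi> p = \<phi> y"
        unfolding y(3) using smooth_atlas_inj[OF A'] i y(1) by (intro local_rep_coord) simp_all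
      then show ?thesis unfolding y(3) \<phi>_def Psi_def profile_def rad[OF y(2,1)] .
    qed
    have g: "g i p = hess (nabla_hat i) (\<lambda>p. profile C (E.rad p)) p" if "p \<in> E.sub C" for p
      unfolding g_def hess_tensor_def by (rule hess_cong[OF E.open_sub that rep])
    have sub: "p $ 3 \<noteq> 0" "p \<in> E.Uhat" if "p \<in> E.sub C" for p
      using E.subD[OF that] E.UhatD by blast+
    have det: "det (g i p) = (p $ 3) ^ 4" if "p \<in> E.sub C" for p
      unfolding g[OF that] by (rule E.det_hess_phi[OF C that])
    show "open (img ?A ?M i)" unfolding img by (rule E.open_sub)
    show "smooth_on (img ?A ?M i) (local_rep ?A i \<phi>)"
      unfolding img by (rule smooth_on_cong[OF E.open_sub rep[symmetric] E.smooth_phi[OF C]])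
    show "det (g i p) = (p $ 3) ^ 4 \<and> p $ 3 \<noteq> 0" if "p \<in> img ?A ?M i" for p
      using det sub that unfolding img by blast
    show "v \<bullet> (g i p *v v) > 0" if "p \<in> img ?A ?M i" "v \<noteq> 0" for p v
      using E.hess_phi_pos[OF C _ that(2), of p] g that(1) unfolding img by simp
    show "curvature (nabla_hat i) j k l m p = 0" if "p \<in> img ?A ?M i" for p j k l m
      using E.curvature_Gh sub that unfolding img by blast
    show "hess (nabla_hat i) (\<lambda>q. ln \<bar>det (g i q) / (\<mu> q)^2\<bar>) p = 0"
      if "open V" "V \<subseteq> img ?A ?M i" "p \<in> V" "smooth_on V \<mu>" "\<And>q. q \<in> V \<Longrightarrow> \<mu> q \<noteq> 0"
        "\<And>q a. q \<in> V \<Longrightarrow> pd a \<mu> q = conn_trace (nabla_hat i) a q * \<mu> q" for V \<mu> p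
      using that(2) sub det unfolding img
      by (intro E.hess_ln_parallel[OF that(1) _ that(3-6)]) auto
  qed
  have M: "openin (manifold_topology ?A) ?M"
    using chart(1) by (auto simp: openin_manifold_topology[OF A'] carrier_hat Mhat_sub_def)
  have \<phi>: "smooth_fun ?A ?M \<phi>" using chart(2) by (simp add: smooth_fun_def)
  \<comment> \<open>Nondegeneracy is read off from the determinant, a fourth power of the
    nonvanishing fibre coordinate.\<close>
  have metric: "metric_on ?A ?M g"
    unfolding g_def by (rule metric_on_hess_tensor[OF A' \<Gamma> M \<phi>]) (use chart(3) g_def in auto)
  have "hess (nabla_hat i) (\<lambda>w. ln \<bar>det (g i w) / (\<mu> i w)^2\<bar>) u = 0"
    if V: "openin (manifold_topology ?A) V" "V \<subseteq> ?M" "parallel_volume_form ?A V nabla_hat \<mu>"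
      and i: "i \<in> chart_ids A" and u: "u \<in> img ?A V i" for V \<mu> i u
  proof (rule chart(6)[OF i _ _ u])
    show "open (img ?A V i)" using V(1) i by (simp add: openin_manifold_topology[OF A'])
    show "img ?A V i \<subseteq> img ?A ?M i" using V(2) by (auto simp: img_def)
  qed (use V(3) i in \<open>auto simp: parallel_volume_form_def\<close>)
  then have "monge_ampere_on ?A ?M nabla_hat g"
    unfolding monge_ampere_on_def flat_on_def using M \<Gamma> metric \<phi> chart(5) g_def
    by (auto intro!: exI[of _ \<phi>])
  moreover have "riemannian_on ?A ?M g"
    unfolding riemannian_on_def using metric chart(4) by simp
  ultimately show ?thesis by blast
qed

end
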